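(* Let $W$ be an s-word with at least two proper letters. Then $W$ is a sunword if and only if $(D_W,\Lambda_W)$ is an evenly weighted Dyck-path.
   Context: Multisuns: a multisun is a graph with no induced $K_4$ minus an edge, of odd order, whose maximal cliques of size $2$ form a Hamiltonian cycle $C$ (the rim); the other maximal cliques consist of pairwise nonconsecutive vertices of $C$ (inscribed cliques). A sub-multisun deletes the edge sets of some, but not all, inscribed cliques. An $AB$-path (inscribed cliques $A,B$, possibly equal) is a subpath of $C$ with one end in $A$, the other in $B$, internal vertices in no inscribed clique; $A$-path $=AA$-path; for $v\in B$ an $Av$-path is an $AB$-path ending at $v$ in $B$. N-conditions: (N1) every $A$-path has an even number $\ge4$ of vertices; (N2) inscribed cliques have odd size; (N3) all inscribed cliques share a vertex $\xi\in V(C)$ and are otherwise disjoint; (N4) every $A\xi$-path has an even number of vertices; (N5) for $A\ne B$ every $AB$-path has an odd number of vertices. A sunoid is a multisun such that it and all its sub-multisuns satisfy the N-conditions. Words: alphabet $\Sigma$ with distinguished letter $\epsilon$; $x^k$ is $k$ copies of $x$. The pattern $\pi(w)$ is obtained by repeatedly deleting $\epsilon\epsilon$. $v\sim w$ if related by cyclic shift and/or reversal; $u\approx v$ iff $\pi(u)\sim\pi(v)$; $[w]$ is the class (cyclic word). For a multisun satisfying the N-conditions, label rim vertices by $\sigma$ (in $\ge2$ inscribed cliques), by a letter specific to $X$ (only in inscribed clique $X$), or $\epsilon$ (in none); reading around the rim gives $w_G$; $[w_G]$ is its s-word. An s-word is a cyclic word either $[a^\lambda]$ ($\Sigma=\{\epsilon,a\}$,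 $\lambda$ odd) or $[\sigma x_{i_1}^{\lambda_1}\epsilon x_{i_2}^{\lambda_2}\epsilon\cdots\epsilon x_{i_s}^{\lambda_s}]$ with positive $\lambda_j$, letters $x_{i_j}\in\Sigma\setminus\{\epsilon,\sigma\}$ (the proper letters), $x_{i_h}\ne x_{i_{h+1}}$, and each proper letter's exponents summing to an even number. A sunword is the s-word of a sunoid. Induced order (for an s-word with at least two proper letters): take a representative $\sigma u$ equal to its own pattern, replace each interval $xx$ of $u$ ($x$ proper) by $x\epsilon\epsilon x$ to get $z$, let $v=\sigma\epsilon\epsilon z\epsilon\epsilon=v_1\cdots v_N$ arranged cyclically; $\sigma$ is least, and for proper $x\ne y$, $x\prec y$ iff the least cyclic distance from position $1$ to a position labeled $x$ is smaller than that for $y$. $D_W,\Lambda_W$: choose the representative $\sigma z_{i_1}^{\lambda_1}\epsilon\cdots\epsilon z_{i_s}^{\lambda_s}$ of $W$ with $z_{i_1}=a$, the $\prec$-least proper letter. Let $h(x)$ be the rank of the proper letter $x$ in $\prec$ with $h(a)=0$, $h(b)=1$, etc. Set $P_j=(j,h(z_{i_{j+1}}))$ for $j=0,\dots,s-1$, $D_W=\{P_0,\dots,P_{s-1}\}$, and $\Lambda_W(j)=\lambda_{j+1}$. A Dyck-path of semilength $n$ is a sequence of lattice points $P_0,\dots,P_{2n}$ with nonnegative ordinates, $P_0=(0,0)$, $P_{2n}=(2n,0)$, $P_{i+1}-P_i\in\{(1,1),(1,-1)\}$. For $1\le i\le 2n-1$, $P_i$ is a peak if $P_{i-1}$ and $P_{i+1}$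 have the same ordinate. $(D,\Lambda)$ with $\Lambda:\{0,\dots,2n\}\to\mathbb{Z}_+$ is evenly weighted if $\Lambda(i)$ is even when $P_i$ is a peak and odd otherwise.
   Formalization: In (N5) AB-paths are taken between vertices of A and B other than the common vertex ξ, since otherwise (N5) contradicts (N1) and (N4); the right side also includes that D_W is defined, i.e. that ≺ has no ties and the required representative exists. *)

theory Defs
  imports Main
begin

text \<open>A finite simple graph on natural-number vertices: vertex set V, adjacency E.
  The rim C is given as a list cs enumerating V in cyclic order.\<close>

definition clique :: "nat set \<Rightarrow> (nat \<Rightarrow> nat \<Rightarrow> bool) \<Rightarrow> nat set \<Rightarrow> bool" where
  "clique V E K \<longleftrightarrow> K \<subseteq> V \<and> (\<forall>x\<in>K. \<forall>y\<in>K. x \<noteq> y \<longrightarrow> E x y)"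

definition maxclique :: "nat set \<Rightarrow> (nat \<Rightarrow> nat \<Rightarrow> bool) \<Rightarrow> nat set \<Rightarrow> bool" where
  "maxclique V E K \<longleftrightarrow> clique V E K \<and> (\<forall>K'. clique V E K' \<and> K \<subseteq> K' \<longrightarrow> K' = K)"

definition inscribed :: "nat set \<Rightarrow> (nat \<Rightarrow> nat \<Rightarrow> bool) \<Rightarrow> nat set set" where
  "inscribed V E = {K. maxclique V E K \<and> card K \<noteq> 2}"

definition no_induced_diamond :: "nat set \<Rightarrow> (nat \<Rightarrow> nat \<Rightarrow> bool) \<Rightarrow> bool" where
  "no_induced_diamond V E \<longleftrightarrow>
     \<not> (\<exists>a\<in>V. \<exists>b\<in>V. \<exists>c\<in>V. \<exists>d\<in>V. distinct [a,b,c,d] \<and>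
          E a b \<and> E a c \<and> E a d \<and> E b c \<and> E b d \<and> \<not> E c d)"

definition consecutive :: "nat list \<Rightarrow> nat \<Rightarrow> nat \<Rightarrow> bool" where
  "consecutive cs x y \<longleftrightarrow> (\<exists>i<length cs.
      (x = cs ! i \<and> y = cs ! ((i + 1) mod length cs)) \<or>
      (y = cs ! i \<and> x = cs ! ((i + 1) mod length cs)))"

definition multisun :: "nat set \<Rightarrow> (nat \<Rightarrow> nat \<Rightarrow> bool) \<Rightarrow> nat list \<Rightarrow> bool" where
  "multisun V E cs \<longleftrightarrow>
     finite V \<and> (\<forall>x y. E x y \<longrightarrow> x \<in> V \<and> y \<in> V) \<and> (\<forall>x y. E x y \<longrightarrow> E y x) \<and> (\<forall>x. \<not> E x x) \<and>
     no_induced_diamond V E \<and> odd (card V) \<and>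
     distinct cs \<and> set cs = V \<and> length cs \<ge> 3 \<and>
     {K. maxclique V E K \<and> card K = 2} =
       {{cs ! i, cs ! ((i + 1) mod length cs)} | i. i < length cs} \<and>
     (\<forall>K\<in>inscribed V E. \<forall>x\<in>K. \<forall>y\<in>K. \<not> consecutive cs x y)"

definition rimv :: "nat list \<Rightarrow> nat \<Rightarrow> nat \<Rightarrow> nat" where
  "rimv cs i j = cs ! ((i + j) mod length cs)"

definition rim_path :: "nat list \<Rightarrow> nat set set \<Rightarrow> nat set \<Rightarrow> nat set \<Rightarrow> nat \<Rightarrow> nat \<Rightarrow> bool" where
  "rim_path cs I P Q i m \<longleftrightarrow>
     i < length cs \<and> 2 \<le> m \<and> m \<le> length cs \<and>
     (\<forall>j. 0 < j \<and> j < m - 1 \<longrightarrow> rimv cs i j \<notin> \<Union>I) \<and>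
     ((rimv cs i 0 \<in> P \<and> rimv cs i (m - 1) \<in> Q) \<or> (rimv cs i 0 \<in> Q \<and> rimv cs i (m - 1) \<in> P))"

definition N1 :: "nat list \<Rightarrow> nat set set \<Rightarrow> bool" where
  "N1 cs I \<longleftrightarrow> (\<forall>A\<in>I. \<forall>i m. rim_path cs I A A i m \<longrightarrow> even m \<and> m \<ge> 4)"

definition N2 :: "nat set set \<Rightarrow> bool" where
  "N2 I \<longleftrightarrow> (\<forall>A\<in>I. odd (card A))"

definition N3 :: "nat list \<Rightarrow> nat set set \<Rightarrow> nat \<Rightarrow> bool" where
  "N3 cs I \<xi> \<longleftrightarrow> \<xi> \<in> set cs \<and> (\<forall>A\<in>I. \<xi> \<in> A) \<and> (\<forall>A\<in>I. \<forall>B\<in>I. A \<noteq> B \<longrightarrow> A \<inter> B = {\<xi>})"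

definition N4 :: "nat list \<Rightarrow> nat set set \<Rightarrow> nat \<Rightarrow> bool" where
  "N4 cs I \<xi> \<longleftrightarrow> (\<forall>A\<in>I. \<forall>i m. rim_path cs I A {\<xi>} i m \<longrightarrow> even m)"

definition N5 :: "nat list \<Rightarrow> nat set set \<Rightarrow> bool" where
  "N5 cs I \<longleftrightarrow> (\<forall>A\<in>I. \<forall>B\<in>I. A \<noteq> B \<longrightarrow> (\<forall>i m. rim_path cs I (A - B) (B - A) i m \<longrightarrow> odd m))"

definition N_conditions :: "nat set \<Rightarrow> (nat \<Rightarrow> nat \<Rightarrow> bool) \<Rightarrow> nat list \<Rightarrow> bool" where
  "N_conditions V E cs \<longleftrightarrow>
     (let I = inscribed V E in N1 cs I \<and> N2 I \<and> (\<exists>\<xi>. N3 cs I \<xi> \<and> N4 cs I \<xi>) \<and> N5 cs I)"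

definition del_edges :: "(nat \<Rightarrow> nat \<Rightarrow> bool) \<Rightarrow> nat set set \<Rightarrow> nat \<Rightarrow> nat \<Rightarrow> bool" where
  "del_edges E S x y \<longleftrightarrow> E x y \<and> \<not> (\<exists>K\<in>S. x \<in> K \<and> y \<in> K)"

definition sunoid :: "nat set \<Rightarrow> (nat \<Rightarrow> nat \<Rightarrow> bool) \<Rightarrow> nat list \<Rightarrow> bool" where
  "sunoid V E cs \<longleftrightarrow> multisun V E cs \<and> N_conditions V E cs \<and>
     (\<forall>S. S \<subseteq> inscribed V E \<and> S \<noteq> {} \<and> S \<noteq> inscribed V E \<longrightarrow>
          N_conditions V (del_edges E S) cs)"

datatype letter = Eps | Sig | Prop nat

inductive del_step :: "letter list \<Rightarrow> letter list \<Rightarrow> bool" where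
  "del_step (xs @ [Eps, Eps] @ ys) (xs @ ys)"

definition has_EpsEps :: "letter list \<Rightarrow> bool" where
  "has_EpsEps u \<longleftrightarrow> (\<exists>xs ys. u = xs @ [Eps, Eps] @ ys)"

definition pattern :: "letter list \<Rightarrow> letter list" where
  "pattern w = (THE u. del_step\<^sup>*\<^sup>* w u \<and> \<not> has_EpsEps u)"

definition word_sim :: "letter list \<Rightarrow> letter list \<Rightarrow> bool" where
  "word_sim v w \<longleftrightarrow> (\<exists>k. v = rotate k w \<or> v = rev (rotate k w))"

definition word_approx :: "letter list \<Rightarrow> letter list \<Rightarrow> bool" where
  "word_approx u v \<longleftrightarrow> word_sim (pattern u) (pattern v)"

definition vlabel :: "nat set \<Rightarrow> (nat \<Rightarrow> nat \<Rightarrow> bool) \<Rightarrow> (nat set \<Rightarrow> nat) \<Rightarrow> nat \<Rightarrow> letter" where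
  "vlabel V E lab v = (let Ks = {K \<in> inscribed V E. v \<in> K} in
      if 2 \<le> card Ks then Sig else if Ks = {} then Eps else Prop (lab (the_elem Ks)))"

definition graph_word :: "nat set \<Rightarrow> (nat \<Rightarrow> nat \<Rightarrow> bool) \<Rightarrow> nat list \<Rightarrow> (nat set \<Rightarrow> nat) \<Rightarrow> letter list" where
  "graph_word V E cs lab = map (vlabel V E lab) cs"

fun blocks_word :: "(nat \<times> nat) list \<Rightarrow> letter list" where
  "blocks_word [] = []"
| "blocks_word [(x, l)] = replicate l (Prop x)"
| "blocks_word ((x, l) # b # r) = replicate l (Prop x) @ [Eps] @ blocks_word (b # r)"

definition sword_of :: "(nat \<times> nat) list \<Rightarrow> letter list" where
  "sword_of bs = Sig # blocks_word bs"

definition sword_blocks :: "(nat \<times> nat) list \<Rightarrow> bool" where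
  "sword_blocks bs \<longleftrightarrow> bs \<noteq> [] \<and> (\<forall>b\<in>set bs. snd b > 0) \<and>
     (\<forall>h. Suc h < length bs \<longrightarrow> fst (bs ! h) \<noteq> fst (bs ! Suc h)) \<and>
     (\<forall>x. even (sum_list (map snd (filter (\<lambda>b. fst b = x) bs))))"

definition letters :: "(nat \<times> nat) list \<Rightarrow> nat set" where
  "letters bs = fst ` set bs"

text \<open>W is a sunword: it is the s-word [w_G] of some sunoid G (w_G \<approx> representative).\<close>
definition sunword :: "letter list \<Rightarrow> bool" where
  "sunword w \<longleftrightarrow> (\<exists>V E cs lab. sunoid V E cs \<and> inj_on lab (inscribed V E) \<and>
                     word_approx (graph_word V E cs lab) w)"

fun expand :: "letter list \<Rightarrow> letter list" where
  "expand (x # y # r) =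
     (if x = y \<and> x \<noteq> Eps \<and> x \<noteq> Sig then x # Eps # Eps # expand (y # r) else x # expand (y # r))"
| "expand xs = xs"

definition vword :: "(nat \<times> nat) list \<Rightarrow> letter list" where
  "vword bs = Sig # Eps # Eps # expand (tl (sword_of bs)) @ [Eps, Eps]"

text \<open>Least cyclic distance from position 1 (index 0) to a position labelled x.\<close>
definition ldist :: "(nat \<times> nat) list \<Rightarrow> nat \<Rightarrow> nat" where
  "ldist bs x = (let v = vword bs; N = length v in
      Min {min i (N - i) | i. i < N \<and> v ! i = Prop x})"

definition prec :: "(nat \<times> nat) list \<Rightarrow> nat \<Rightarrow> nat \<Rightarrow> bool" where
  "prec bs x y \<longleftrightarrow> ldist bs x < ldist bs y"

definition prec_total :: "(nat \<times> nat) list \<Rightarrow> bool" where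
  "prec_total bs \<longleftrightarrow> (\<forall>x\<in>letters bs. \<forall>y\<in>letters bs. x \<noteq> y \<longrightarrow> prec bs x y \<or> prec bs y x)"

definition least_letter :: "(nat \<times> nat) list \<Rightarrow> nat" where
  "least_letter bs = (THE a. a \<in> letters bs \<and> (\<forall>y\<in>letters bs. y \<noteq> a \<longrightarrow> prec bs a y))"

definition rank :: "(nat \<times> nat) list \<Rightarrow> nat \<Rightarrow> nat" where
  "rank bs x = card {y \<in> letters bs. prec bs y x}"

definition repr :: "(nat \<times> nat) list \<Rightarrow> (nat \<times> nat) list" where
  "repr bs = (if fst (hd bs) = least_letter bs then bs else rev bs)"

definition D_W :: "(nat \<times> nat) list \<Rightarrow> (int \<times> int) list" where
  "D_W bs = map (\<lambda>j. (int j, int (rank bs (fst (repr bs ! j))))) [0..<length bs]"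

definition Lambda_W :: "(nat \<times> nat) list \<Rightarrow> nat \<Rightarrow> nat" where
  "Lambda_W bs j = snd (repr bs ! j)"

definition DW_defined :: "(nat \<times> nat) list \<Rightarrow> bool" where
  "DW_defined bs \<longleftrightarrow> prec_total bs \<and> fst (hd (repr bs)) = least_letter bs"

definition dyck_path :: "(int \<times> int) list \<Rightarrow> nat \<Rightarrow> bool" where
  "dyck_path P n \<longleftrightarrow> length P = 2 * n + 1 \<and>
     (\<forall>i \<le> 2 * n. snd (P ! i) \<ge> 0) \<and>
     P ! 0 = (0, 0) \<and> P ! (2 * n) = (int (2 * n), 0) \<and>
     (\<forall>i < 2 * n. fst (P ! Suc i) - fst (P ! i) = 1 \<and>
                  (snd (P ! Suc i) - snd (P ! i) = 1 \<or> snd (P ! Suc i) - snd (P ! i) = -1))"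

definition is_peak :: "(int \<times> int) list \<Rightarrow> nat \<Rightarrow> nat \<Rightarrow> bool" where
  "is_peak P n i \<longleftrightarrow> 1 \<le> i \<and> i \<le> 2 * n - 1 \<and> snd (P ! (i - 1)) = snd (P ! (i + 1))"

definition evenly_weighted_dyck :: "(int \<times> int) list \<Rightarrow> (nat \<Rightarrow> nat) \<Rightarrow> bool" where
  "evenly_weighted_dyck P \<Lambda> \<longleftrightarrow> (\<exists>n. dyck_path P n \<and> (\<forall>i \<le> 2 * n. \<Lambda> i > 0) \<and>
     (\<forall>i \<le> 2 * n. (is_peak P n i \<longrightarrow> even (\<Lambda> i)) \<and> (\<not> is_peak P n i \<longrightarrow> odd (\<Lambda> i))))"

end

theory Submission
  imports Defs
begin

text \<open>Number the rim from the common vertex. Conditions N1 and N5, applied to the sub-multisuns with one and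
  with two inscribed cliques, say exactly that the vertices specific to one clique alternate in parity
  along the rim and that neighbouring vertices specific to two different cliques, in the absence of the
  others, have equal parity. Hence a sunword is characterised by prefix counts: there is a linear order of
  the proper letters such that at each occurrence of \<open>x\<close> precisely the letters below \<open>x\<close> have occurred
  an odd number of times (\<open>x\<close> itself excepted). Comparing this condition at consecutive blocks shows
  that their letters are neighbours in the order, which gives a Dyck path, and determines the parities of
  the weights. The order is the induced one because each lower letter
  occurs both before and after every occurrence of a higher one.\<close>

section \<open>Deleting pairs of blanks\<close>

text \<open>A cyclic word has neither starting point nor direction, and reduction hides how many
  blanks the rim really carries. All of this is neutralised before any counting: \<open>Sig\<close>
  marks a single rim vertex, so cutting there fixes the rotation; the parity conditions survive
  reversal; and they see a position only modulo 2, so deleting two adjacent blanks does not change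
  them. Conversely, the word \<open>vword\<close>, made to define the induced order, also serves as
  the rim of a sunoid: its extra pairs of blanks keep clique vertices apart without touching any
  parity, and the odd number of points of a Dyck path makes the rim odd. The order of the letters is
  kept as an arbitrary injective \<open>h\<close>, because it arises in two ways: from first
  occurrences in a sunoid, and from \<open>rank\<close> for a given Dyck path. That
  \<open>prec\<close> is total and that the path starts with its least letter
  (\<open>DW_defined\<close>) belongs to the claim and has to be derived from
  \<open>h\<close>.\<close>

fun red :: "letter list \<Rightarrow> letter list" where
  "red [] = []"
| "red (Eps # u) = (case red u of Eps # v \<Rightarrow> v | v \<Rightarrow> Eps # v)"
| "red (x # u) = x # red u"

lemma has_EpsEps_Cons [simp]:
  "has_EpsEps (x # u) \<longleftrightarrow> (x = Eps \<and> u \<noteq> [] \<and> hd u = Eps) \<or> has_EpsEps u"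
proof
  assume "has_EpsEps (x # u)"
  then obtain xs ys where e: "x # u = xs @ [Eps, Eps] @ ys"
    by (auto simp: has_EpsEps_def)
  then show "(x = Eps \<and> u \<noteq> [] \<and> hd u = Eps) \<or> has_EpsEps u"
    by (cases xs) (auto simp: has_EpsEps_def)
next
  assume "(x = Eps \<and> u \<noteq> [] \<and> hd u = Eps) \<or> has_EpsEps u"
  then show "has_EpsEps (x # u)"
  proof
    assume "x = Eps \<and> u \<noteq> [] \<and> hd u = Eps"
    then have "x # u = [] @ [Eps, Eps] @ tl u" by (cases u) auto
    then show ?thesis unfolding has_EpsEps_def by blast
  next
    assume "has_EpsEps u"
    then obtain xs ys where "u = xs @ [Eps, Eps] @ ys" by (auto simp: has_EpsEps_def)
    then have "x # u = (x # xs) @ [Eps, Eps] @ ys" by simp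
    then show ?thesis unfolding has_EpsEps_def by blast
  qed
qed

lemma has_EpsEps_Nil [simp]: "\<not> has_EpsEps []"
  by (simp add: has_EpsEps_def)

lemma has_EpsEps_rev: "has_EpsEps (rev u) \<longleftrightarrow> has_EpsEps u"
proof -
  have "has_EpsEps (rev u)" if "has_EpsEps u" for u
  proof -
    from that obtain xs ys where "u = xs @ [Eps, Eps] @ ys" by (auto simp: has_EpsEps_def)
    then have "rev u = rev ys @ [Eps, Eps] @ rev xs" by simp
    then show ?thesis unfolding has_EpsEps_def by blast
  qed
  from this[of u] this[of "rev u"] show ?thesis by auto
qed

lemma not_has_EpsEps_red: "\<not> has_EpsEps (red u)"
  by (induction u rule: red.induct) (auto split: list.split letter.split)

lemma red_id: "\<not> has_EpsEps u \<Longrightarrow> red u = u"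
proof (induction u)
  case (Cons x u)
  then show ?case by (cases x; cases u) (auto split: letter.split)
qed simp

text \<open>\<open>red u\<close> starts with at most one blank, so a blank put in front acts as a
  toggle: it is added or it cancels, and toggling twice restores \<open>red u\<close>.\<close>

lemma red_Eps_Eps [simp]: "red (Eps # Eps # u) = red u"
proof (cases "red u")
  case (Cons x v)
  then show ?thesis using not_has_EpsEps_red[of u] by (cases x; cases v; cases "hd v") auto
qed simp

lemma red_append_cong: "red u = red v \<Longrightarrow> red (w @ u) = red (w @ v)"
  by (induction w rule: red.induct) auto

lemma red_del_step: "del_step u v \<Longrightarrow> red u = red v"
  proof (induction rule: del_step.induct)
  case (1 xs ys)
  show ?case by (rule red_append_cong) (simp del: red.simps)
qed

lemma red_del_steps: "del_step\<^sup>*\<^sup>* u v \<Longrightarrow> red u = red v"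
  by (induction rule: rtranclp_induct) (metis red_del_step)+

lemma del_step_Cons: "del_step u v \<Longrightarrow> del_step (x # u) (x # v)"
proof (induction rule: del_step.induct)
  case (1 xs ys)
  then show ?case using del_step.intros[of "x # xs" ys] by simp
qed

lemma del_steps_Cons: "del_step\<^sup>*\<^sup>* u v \<Longrightarrow> del_step\<^sup>*\<^sup>* (x # u) (x # v)"
  by (induction rule: rtranclp_induct) (auto intro: del_step_Cons rtranclp.rtrancl_into_rtrancl)

lemma del_step_rev: "del_step u v \<Longrightarrow> del_step (rev u) (rev v)"
proof (induction rule: del_step.induct)
  case (1 xs ys)
  then show ?case using del_step.intros[of "rev ys" "rev xs"] by simp
qed

lemma del_steps_rev: "del_step\<^sup>*\<^sup>* u v \<Longrightarrow> del_step\<^sup>*\<^sup>* (rev u) (rev v)"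
  by (induction rule: rtranclp_induct) (auto intro: del_step_rev rtranclp.rtrancl_into_rtrancl)

lemma del_steps_red: "del_step\<^sup>*\<^sup>* u (red u)"
proof (induction u rule: red.induct)
  case (2 u)
  have 1: "del_step\<^sup>*\<^sup>* (Eps # u) (Eps # red u)" by (rule del_steps_Cons) fact
  show ?case
  proof (cases "\<exists>v. red u = Eps # v")
    case True
    then obtain v where v: "red u = Eps # v" by blast
    have "del_step (Eps # Eps # v) v" using del_step.intros[of "[]" v] by simp
    then show ?thesis using 1 v by simp
  next
    case False
    then have "red (Eps # u) = Eps # red u" by (auto split: list.split letter.split)
    then show ?thesis using 1 by simp
  qed
qed (auto intro: del_steps_Cons)

text \<open>Uniqueness needs no confluence argument: \<open>red\<close> is constant along deletions
  and fixes irreducible words, so \<open>red w\<close> is the only irreducible word reachable from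
  \<open>w\<close>.\<close>

lemma pattern_eq_red: "pattern w = red w"
  unfolding pattern_def
proof (rule the_equality)
  show "del_step\<^sup>*\<^sup>* w (red w) \<and> \<not> has_EpsEps (red w)"
    using del_steps_red not_has_EpsEps_red by blast
  show "u = red w" if "del_step\<^sup>*\<^sup>* w u \<and> \<not> has_EpsEps u" for u
    using that red_del_steps red_id by metis
qed

lemma red_rev: "red (rev u) = rev (red u)"
proof -
  have "red (rev u) = red (rev (red u))"
    by (rule red_del_steps[OF del_steps_rev[OF del_steps_red]])
  also have "\<dots> = rev (red u)"
    by (rule red_id) (simp add: has_EpsEps_rev not_has_EpsEps_red)
  finally show ?thesis .
qed

lemma red_red [simp]: "red (red u) = red u"
  by (rule red_id[OF not_has_EpsEps_red])

lemma red_red_append: "red (red u @ red v) = red (u @ v)"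
proof -
  have "red (red u @ v) = rev (red (rev v @ rev (red u)))"
    by (simp flip: red_rev)
  also have "red (rev v @ rev (red u)) = red (rev v @ rev u)"
    by (rule red_append_cong) (simp add: red_rev)
  also have "rev \<dots> = red (u @ v)" by (simp flip: red_rev)
  finally have "red (red u @ v) = red (u @ v)" .
  moreover have "red (red u @ red v) = red (red u @ v)"
    by (rule red_append_cong) simp
  ultimately show ?thesis by simp
qed

text \<open>\<open>Sig\<close> never cancels and stops cancellation across it, so the two sides
  reduce independently. This locates the common vertex in a reduced rim word.\<close>

lemma red_append_Sig: "red (u @ Sig # v) = red u @ Sig # red v"
proof -
  have "red (u @ Sig # v) = red (red u @ Sig # red v)"
    using red_red_append[of u "Sig # v"] by simp
  also have "\<dots> = red u @ Sig # red v"
  proof (rule red_id)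
    have "\<not> has_EpsEps (a @ Sig # b)" if "\<not> has_EpsEps a" "\<not> has_EpsEps b" for a b
      using that by (induction a) (auto simp: neq_Nil_conv hd_append)
    then show "\<not> has_EpsEps (red u @ Sig # red v)" by (simp add: not_has_EpsEps_red)
  qed
  finally show ?thesis .
qed

lemma in_set_red: "x \<noteq> Eps \<Longrightarrow> x \<in> set (red u) \<longleftrightarrow> x \<in> set u"
proof (induction u rule: red.induct)
  case (2 u)
  then show ?case by (auto split: list.split letter.split)
qed auto

text \<open>Read with \<open>n\<close> the number of letters and \<open>c x\<close> the number of letters \<open>x\<close> before the current position.
  The condition at \<open>x\<close> says that the occurrences of \<open>x\<close> alternate in parity, and that a letter
  \<open>y\<close> has been met an odd number of times exactly if it precedes \<open>x\<close> in the order given by \<open>h\<close>.\<close>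
fun scan :: "nat set \<Rightarrow> (nat \<Rightarrow> nat) \<Rightarrow> nat \<Rightarrow> (nat \<Rightarrow> nat) \<Rightarrow> letter list \<Rightarrow> bool" where
  "scan L h n c [] \<longleftrightarrow> True"
| "scan L h n c (Prop x # t) \<longleftrightarrow> (even n \<longleftrightarrow> even (c x)) \<and>
     (\<forall>y\<in>L - {x}. odd (c y) \<longleftrightarrow> h y < h x) \<and> scan L h (Suc n) (c(x := Suc (c x))) t"
| "scan L h n c (z # t) \<longleftrightarrow> scan L h (Suc n) c t"

text \<open>The position enters \<open>scan\<close> only through its parity. Hence a pair of blanks,
  which advances the position by two and changes no count, is invisible.\<close>

lemma scan_Suc_Suc [simp]: "scan L h (Suc (Suc n)) c t = scan L h n c t"
proof (induction t arbitrary: n c)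
  case (Cons z t)
  then show ?case by (cases z) (simp_all del: fun_upd_apply)
qed simp

lemma scan_append:
  "scan L h n c (s @ t) \<longleftrightarrow> scan L h n c s \<and>
     scan L h (n + length s) (\<lambda>x. c x + count_list s (Prop x)) t"
proof (induction L h n c s rule: scan.induct)
  case (2 L h n c x s)
  have eq: "(\<lambda>y. (c(x := Suc (c x))) y + count_list s (Prop y)) =
        (\<lambda>y. c y + count_list (Prop x # s) (Prop y))"
    by (rule ext) simp
  show ?case
    unfolding append_Cons scan.simps(2) 2 eq list.size by simp
qed auto

lemma scan_red: "scan L h n c (red t) = scan L h n c t"
proof -
  have step: "scan L h n c u = scan L h n c v" if "del_step u v" for u v
    using that
  proof cases
    case (1 xs ys)
    then show ?thesis by (simp add: scan_append)
  qed
  have "scan L h n c u = scan L h n c v" if "del_step\<^sup>*\<^sup>* u v" for u v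
    using that by (induction rule: rtranclp_induct) (simp_all add: step)
  from this[OF del_steps_red] show ?thesis by simp
qed

lemma scan_iff_nth:
  "scan L h n c t \<longleftrightarrow> (\<forall>i<length t. \<forall>x. t ! i = Prop x \<longrightarrow>
     (even (n + i) \<longleftrightarrow> even (c x + count_list (take i t) (Prop x))) \<and>
     (\<forall>y\<in>L - {x}. odd (c y + count_list (take i t) (Prop y)) \<longleftrightarrow> h y < h x))"
proof (induction t arbitrary: n c)
  case (Cons z t)
  show ?case
  proof (cases "\<exists>x. z = Prop x")
    case True
    then obtain x where z: "z = Prop x" by blast
    have c: "c y + count_list (Prop x # take i t) (Prop y) =
        (c(x := Suc (c x))) y + count_list (take i t) (Prop y)" for y i
      by simp
    show ?thesis
      unfolding z scan.simps(2) Cons length_Cons All_less_Suc2 nth_Cons_0 nth_Cons_Suc take_Suc_Cons c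
      by simp
  next
    case False
    then have "scan L h n c (z # t) = scan L h (Suc n) c t" by (cases z) auto
    then show ?thesis
      unfolding Cons length_Cons All_less_Suc2 nth_Cons_0 nth_Cons_Suc take_Suc_Cons
      using False by simp
  qed
qed simp

section \<open>Sub-multisuns\<close>

text \<open>A vertex \<open>r\<close> of one clique outside the other has a non-neighbour
  \<open>s\<close> there, by maximality; with the shared edge \<open>p\<close>, \<open>q\<close>
  this would be an induced K4 minus an edge.\<close>

lemma maxclique_eqI:
  assumes "\<And>x y. E x y \<Longrightarrow> E y x" "\<And>x. \<not> E x x" and dia: "no_induced_diamond V E"
    and "maxclique V E K" "maxclique V E K'" and pq: "p \<noteq> q" "{p, q} \<subseteq> K \<inter> K'"
  shows "K = K'"
proof -
  have "K \<subseteq> K'" if K: "maxclique V E K" and K': "maxclique V E K'" and pq: "{p, q} \<subseteq> K \<inter> K'"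
    for K K'
  proof
    fix r assume r: "r \<in> K"
    show "r \<in> K'"
    proof (rule ccontr)
      assume nr: "r \<notin> K'"
      have "\<not> clique V E (insert r K')"
        using K' nr unfolding maxclique_def by blast
      moreover have "r \<in> V" "K' \<subseteq> V" using K K' r unfolding maxclique_def clique_def by auto
      ultimately obtain s where s: "s \<in> K'" "s \<noteq> r" "\<not> E r s"
        using K' assms(1) unfolding maxclique_def clique_def by (smt (verit) insert_iff insert_subset)
      have Er: "E p r" "E q r" "E p q"
        using K r pq nr \<open>p \<noteq> q\<close> unfolding maxclique_def clique_def by auto
      then have "s \<noteq> p" "s \<noteq> q" using s assms(1) by blast+
      then have Es: "E p s" "E q s"
        using K' s pq unfolding maxclique_def clique_def by auto
      have "p \<in> V" "q \<in> V" "s \<in> V" "r \<in> V"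
        using pq K s K' r unfolding maxclique_def clique_def by auto
      moreover have "distinct [p, q, r, s]"
        using \<open>p \<noteq> q\<close> \<open>s \<noteq> p\<close> \<open>s \<noteq> q\<close> s pq nr by auto
      ultimately show False using dia Er Es s unfolding no_induced_diamond_def by blast
    qed
  qed
  from this[OF assms(4,5)] this[OF assms(5,4)] pq(2) show ?thesis by blast
qed

lemma clique_extend:
  assumes "finite V" "clique V E K"
  obtains K' where "maxclique V E K'" "K \<subseteq> K'"
proof -
  have "finite {K'. clique V E K' \<and> K \<subseteq> K'}"
    by (rule finite_subset[of _ "Pow V"]) (use assms in \<open>auto simp: clique_def\<close>)
  from finite_has_maximal[OF this] assms(2) obtain K' where
    "clique V E K'" "K \<subseteq> K'" "\<forall>K''. clique V E K'' \<and> K \<subseteq> K'' \<longrightarrow> K' \<subseteq> K'' \<longrightarrow> K' = K''"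
    by auto
  then show thesis using that unfolding maxclique_def by blast
qed

lemma multisunD:
  assumes "multisun V E cs"
  shows "finite V" "E x y \<Longrightarrow> x \<in> V \<and> y \<in> V" "E x y \<Longrightarrow> E y x" "\<not> E x x"
    "no_induced_diamond V E" "odd (card V)" "distinct cs" "set cs = V" "length cs \<ge> 3"
    "{K. maxclique V E K \<and> card K = 2} =
       {{cs ! i, cs ! ((i + 1) mod length cs)} | i. i < length cs}"
    "K \<in> inscribed V E \<Longrightarrow> x \<in> K \<Longrightarrow> y \<in> K \<Longrightarrow> \<not> consecutive cs x y"
proof -
  note A = assms[unfolded multisun_def]
  show "finite V" using A[THEN conjunct1] .
  show "E x y \<Longrightarrow> x \<in> V \<and> y \<in> V" using A[THEN conjunct2, THEN conjunct1] by simp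
  show "E x y \<Longrightarrow> E y x" using A[THEN conjunct2, THEN conjunct2, THEN conjunct1] by simp
  show "\<not> E x x" using A[THEN conjunct2, THEN conjunct2, THEN conjunct2, THEN conjunct1] by simp
  show "no_induced_diamond V E" using A[THEN conjunct2, THEN conjunct2, THEN conjunct2, THEN conjunct2, THEN conjunct1] .
  show "odd (card V)" using A[THEN conjunct2, THEN conjunct2, THEN conjunct2, THEN conjunct2, THEN conjunct2, THEN conjunct1] .
  show "distinct cs" using A[THEN conjunct2, THEN conjunct2, THEN conjunct2, THEN conjunct2, THEN conjunct2, THEN conjunct2, THEN conjunct1] .
  show "set cs = V" using A[THEN conjunct2, THEN conjunct2, THEN conjunct2, THEN conjunct2, THEN conjunct2, THEN conjunct2, THEN conjunct2, THEN conjunct1] .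
  show "length cs \<ge> 3" using A[THEN conjunct2, THEN conjunct2, THEN conjunct2, THEN conjunct2, THEN conjunct2, THEN conjunct2, THEN conjunct2, THEN conjunct2, THEN conjunct1] .
  show "{K. maxclique V E K \<and> card K = 2} =
       {{cs ! i, cs ! ((i + 1) mod length cs)} | i. i < length cs}" using A[THEN conjunct2, THEN conjunct2, THEN conjunct2, THEN conjunct2, THEN conjunct2, THEN conjunct2, THEN conjunct2, THEN conjunct2, THEN conjunct2, THEN conjunct1] .
  show "K \<in> inscribed V E \<Longrightarrow> x \<in> K \<Longrightarrow> y \<in> K \<Longrightarrow> \<not> consecutive cs x y"
    using A[THEN conjunct2, THEN conjunct2, THEN conjunct2, THEN conjunct2, THEN conjunct2, THEN conjunct2, THEN conjunct2, THEN conjunct2, THEN conjunct2, THEN conjunct2] by simp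
qed

text \<open>\<open>inscribed\<close> admits every cardinality other than 2, so maximal cliques with
  fewer than two vertices have to be excluded. Each vertex has a rim edge, and rim edges survive the
  deletion because inscribed cliques contain no consecutive vertices.\<close>

lemma maxclique_two_elements:
  assumes "multisun V E cs" "S \<subseteq> inscribed V E" "maxclique V (del_edges E S) K"
  shows "\<exists>p\<in>K. \<exists>q\<in>K. p \<noteq> q"
proof (rule ccontr)
  note ms = multisunD[OF assms(1)]
  assume no: "\<not> ?thesis"
  have "K \<subseteq> V" using assms(3) unfolding maxclique_def clique_def by blast
  moreover have "cs ! 0 \<in> V" using ms(8,9) by (metis nth_mem not_numeral_le_zero neq0_conv)
  ultimately obtain p where p: "p \<in> V" "K \<subseteq> {p}"
    using no by (cases "K = {}") blast+
  obtain i where i: "i < length cs" "p = cs ! i" using p ms(8) by (metis in_set_conv_nth)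
  let ?q = "cs ! ((i + 1) mod length cs)"
  have "{p, ?q} \<in> {{cs ! i, cs ! ((i + 1) mod length cs)} | i. i < length cs}" using i by blast
  then have rim: "maxclique V E {p, ?q}" "card {p, ?q} = 2" unfolding ms(10)[symmetric] by simp_all
  then have "?q \<noteq> p" by auto
  have "\<not> (\<exists>K'\<in>S. p \<in> K' \<and> ?q \<in> K')"
  proof
    assume "\<exists>K'\<in>S. p \<in> K' \<and> ?q \<in> K'"
    then obtain K' where "K' \<in> inscribed V E" "p \<in> K'" "?q \<in> K'" using assms(2) by blast
    moreover have "consecutive cs p ?q" using i unfolding consecutive_def by blast
    ultimately show False using ms(11) by blast
  qed
  then have "clique V (del_edges E S) {p, ?q}"
    using rim(1) unfolding maxclique_def clique_def del_edges_def by auto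
  then have "K = {p, ?q}" using assms(3) p(2) unfolding maxclique_def by blast
  then show False using no \<open>?q \<noteq> p\<close> by blast
qed

text \<open>Distinct maximal cliques share at most one vertex, so deleting the edges of
  \<open>S\<close> harms no maximal clique outside \<open>S\<close>. Conversely a new maximal clique
  extends to an old one, which is not in \<open>S\<close> since it contains a surviving edge, and so
  coincides with it.\<close>

lemma inscribed_del_edges:
  assumes "multisun V E cs" "S \<subseteq> inscribed V E"
  shows "inscribed V (del_edges E S) = inscribed V E - S"
proof -
  note ms = multisunD[OF assms(1)]
  note two = maxclique_two_elements[OF assms]
  have eqI: "K = K'" if "maxclique V E K" "maxclique V E K'" "p \<noteq> q" "{p, q} \<subseteq> K \<inter> K'" for K K' p q
    using ms(3,4,5) that by (rule maxclique_eqI)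
  have sub: "clique V E K" if "clique V (del_edges E S) K" for K
    using that unfolding clique_def del_edges_def by blast
  have keep: "maxclique V (del_edges E S) K" if K: "maxclique V E K" "K \<notin> S" for K
  proof -
    have nS: "\<not> (\<exists>K'\<in>S. x \<in> K' \<and> y \<in> K')" if xy: "x \<in> K" "y \<in> K" "x \<noteq> y" for x y
    proof
      assume "\<exists>K'\<in>S. x \<in> K' \<and> y \<in> K'"
      then obtain K' where K': "K' \<in> S" "x \<in> K'" "y \<in> K'" by blast
      then have "maxclique V E K'" using assms(2) unfolding inscribed_def by blast
      then have "K = K'" using eqI[OF K(1), of K' x y] xy K' by simp
      then show False using K(2) K'(1) by simp
    qed
    have "K \<subseteq> V" using K(1) unfolding maxclique_def clique_def by simp
    moreover have "E x y" if "x \<in> K" "y \<in> K" "x \<noteq> y" for x y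
      using K(1) that unfolding maxclique_def clique_def by simp
    ultimately have "clique V (del_edges E S) K"
      unfolding clique_def del_edges_def using nS by (intro conjI ballI impI) assumption+
    moreover have "K' = K" if "clique V (del_edges E S) K'" "K \<subseteq> K'" for K'
      using sub[OF that(1)] that(2) K(1) unfolding maxclique_def by simp
    ultimately show ?thesis unfolding maxclique_def by simp
  qed
  show ?thesis
  proof (intro equalityI subsetI)
    fix K assume "K \<in> inscribed V (del_edges E S)"
    then have K: "maxclique V (del_edges E S) K" "card K \<noteq> 2" by (auto simp: inscribed_def)
    obtain p q where pq: "p \<in> K" "q \<in> K" "p \<noteq> q" using two[OF K(1)] by blast
    obtain K' where K': "maxclique V E K'" "K \<subseteq> K'"
      by (rule clique_extend[OF ms(1) sub[of K]]) (use K(1) in \<open>auto simp: maxclique_def\<close>)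
    have "del_edges E S p q"
      using K(1) pq unfolding maxclique_def clique_def by simp
    then have "K' \<notin> S" using pq K'(2) unfolding del_edges_def by blast
    then have "maxclique V (del_edges E S) K'" by (rule keep[OF K'(1)])
    then have "K = K'" using K(1) K'(2) unfolding maxclique_def by simp
    then show "K \<in> inscribed V E - S" using K' K \<open>K' \<notin> S\<close> by (auto simp: inscribed_def)
  next
    fix K assume "K \<in> inscribed V E - S"
    then show "K \<in> inscribed V (del_edges E S)" using keep by (auto simp: inscribed_def)
  qed
qed

text \<open>The edge relation enters the N-conditions only through the set of inscribed cliques.
  With this family as a parameter, sub-multisuns become subfamilies over one fixed rim.\<close>

definition N_family :: "nat list \<Rightarrow> nat set set \<Rightarrow> bool" where
  "N_family cs T \<longleftrightarrow> N1 cs T \<and> N2 T \<and> (\<exists>\<xi>. N3 cs T \<xi> \<and> N4 cs T \<xi>) \<and> N5 cs T"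

lemma N_conditions_iff: "N_conditions V E cs \<longleftrightarrow> N_family cs (inscribed V E)"
  by (simp add: N_conditions_def N_family_def Let_def)

lemma sunoid_iff:
  assumes "inscribed V E \<noteq> {}"
  shows "sunoid V E cs \<longleftrightarrow> multisun V E cs \<and>
     (\<forall>T. T \<subseteq> inscribed V E \<and> T \<noteq> {} \<longrightarrow> N_family cs T)"
proof (cases "multisun V E cs")
  case True
  note ins = inscribed_del_edges[OF True]
  show ?thesis
  proof
    assume S: "sunoid V E cs"
    have "N_family cs T" if T: "T \<subseteq> inscribed V E" "T \<noteq> {}" for T
    proof (cases "T = inscribed V E")
      case False
      let ?S = "inscribed V E - T"
      have "N_conditions V (del_edges E ?S) cs"
        using S T False unfolding sunoid_def by blast
      moreover have "inscribed V E - ?S = T" using T by blast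
      ultimately show ?thesis unfolding N_conditions_iff using ins[of ?S] by simp
    qed (use S in \<open>auto simp: sunoid_def N_conditions_iff\<close>)
    then show "multisun V E cs \<and> (\<forall>T. T \<subseteq> inscribed V E \<and> T \<noteq> {} \<longrightarrow> N_family cs T)"
      using True by blast
  next
    assume R: "multisun V E cs \<and> (\<forall>T. T \<subseteq> inscribed V E \<and> T \<noteq> {} \<longrightarrow> N_family cs T)"
    have "N_conditions V (del_edges E S) cs"
      if "S \<subseteq> inscribed V E" "S \<noteq> inscribed V E" for S
      unfolding N_conditions_iff ins[OF that(1)] using R that by blast
    moreover have "N_conditions V E cs" using R assms by (simp add: N_conditions_iff)
    ultimately show "sunoid V E cs" using True unfolding sunoid_def by blast
  qed
qed (simp add: sunoid_def)

section \<open>From a sunoid to its word\<close>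

text \<open>Meant for words framed by \<open>Sig\<close> at both ends: the common vertex is cut into
  a first and a last position, so that rim paths become intervals. As \<open>q - p\<close> is one
  less than the number of vertices, the parities are opposite to those in \<open>N1\<close> and
  \<open>N5\<close>. Other proper letters may lie in between, since their cliques can be
  deleted.\<close>

definition alternating :: "letter list \<Rightarrow> bool" where
  "alternating w \<longleftrightarrow>
     (\<forall>x p q. Prop x \<in> set w \<and> p < q \<and> q < length w \<and> w ! p \<in> {Sig, Prop x} \<and> w ! q \<in> {Sig, Prop x} \<and>
        (\<forall>r. p < r \<and> r < q \<longrightarrow> w ! r \<notin> {Sig, Prop x}) \<longrightarrow> odd (q - p)) \<and>
     (\<forall>x y p q. x \<noteq> y \<and> p < q \<and> q < length w \<and> w ! p = Prop x \<and> w ! q = Prop y \<and>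
        (\<forall>r. p < r \<and> r < q \<longrightarrow> w ! r \<notin> {Sig, Prop x, Prop y}) \<longrightarrow> even (q - p))"

lemma alternatingD1:
  assumes "alternating w" "Prop x \<in> set w" "p < q" "q < length w"
    "w ! p \<in> {Sig, Prop x}" "w ! q \<in> {Sig, Prop x}"
    "\<And>r. p < r \<Longrightarrow> r < q \<Longrightarrow> w ! r \<notin> {Sig, Prop x}"
  shows "odd (q - p)"
  using assms unfolding alternating_def by blast

lemma alternatingD2:
  assumes "alternating w" "x \<noteq> y" "p < q" "q < length w" "w ! p = Prop x" "w ! q = Prop y"
    "\<And>r. p < r \<Longrightarrow> r < q \<Longrightarrow> w ! r \<notin> {Sig, Prop x, Prop y}"
  shows "even (q - p)"
  using assms unfolding alternating_def by blast

text \<open>The mirror map from \<open>p\<close> to \<open>length w - 1 - p\<close> preserves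
  distances. Needed because \<open>word_sim\<close> may reverse the rim word.\<close>

lemma alternating_rev:
  assumes "alternating w"
  shows "alternating (rev w)"
  unfolding alternating_def
proof (intro conjI allI impI; elim conjE)
  fix x p q
  assume a: "Prop x \<in> set (rev w)" "p < q" "q < length (rev w)" "rev w ! p \<in> {Sig, Prop x}"
    "rev w ! q \<in> {Sig, Prop x}" "\<forall>r. p < r \<and> r < q \<longrightarrow> rev w ! r \<notin> {Sig, Prop x}"
  let ?n = "length w - 1"
  have rv: "rev w ! r = w ! (?n - r)" if "r < length w" for r using that by (simp add: rev_nth)
  have "odd ((?n - p) - (?n - q))"
  proof (rule alternatingD1[OF assms])
    fix r assume "?n - q < r" "r < ?n - p"
    then show "w ! r \<notin> {Sig, Prop x}"
      using a(6)[rule_format, of "?n - r"] rv[of "?n - r"] a(3) by fastforce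
  qed (use a rv[of p] rv[of q] in auto)
  moreover have "(?n - p) - (?n - q) = q - p" using a by auto
  ultimately show "odd (q - p)" by argo
next
  fix x y p q
  assume a: "x \<noteq> y" "p < q" "q < length (rev w)" "rev w ! p = Prop x" "rev w ! q = Prop y"
    "\<forall>r. p < r \<and> r < q \<longrightarrow> rev w ! r \<notin> {Sig, Prop x, Prop y}"
  let ?n = "length w - 1"
  have rv: "rev w ! r = w ! (?n - r)" if "r < length w" for r using that by (simp add: rev_nth)
  have "even ((?n - p) - (?n - q))"
  proof (rule alternatingD2[OF assms, of y x])
    fix r assume "?n - q < r" "r < ?n - p"
    then show "w ! r \<notin> {Sig, Prop y, Prop x}"
      using a(6)[rule_format, of "?n - r"] rv[of "?n - r"] a(3) by fastforce
  qed (use a rv[of p] rv[of q] in auto)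
  moreover have "(?n - p) - (?n - q) = q - p" using a by auto
  ultimately show "even (q - p)" by argo
qed

section \<open>Prefix parities of an alternating word\<close>

lemma last_below:
  fixes i :: nat
  assumes "q < i" "P q"
  obtains q' where "q' < i" "P q'" "\<And>r. q' < r \<Longrightarrow> r < i \<Longrightarrow> \<not> P r"
proof -
  let ?M = "Max {q. q < i \<and> P q}"
  have fin: "finite {q. q < i \<and> P q}" by simp
  have "?M \<in> {q. q < i \<and> P q}" using assms by (intro Max_in fin) blast
  moreover have "\<not> P r" if "?M < r" "r < i" for r
  proof
    assume "P r"
    then have "r \<le> ?M" using that(2) by (intro Max_ge fin) simp
    then show False using that(1) by simp
  qed
  ultimately show thesis using that by blast
qed

lemma count_take_Suc:
  "i < length t \<Longrightarrow> count_list (take (Suc i) t) a = count_list (take i t) a + (if t ! i = a then 1 else 0)"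
  by (simp add: take_Suc_conv_app_nth)

lemma count_take_eq:
  assumes "i \<le> j" "j \<le> length t" "\<And>r. i \<le> r \<Longrightarrow> r < j \<Longrightarrow> t ! r \<noteq> a"
  shows "count_list (take j t) a = count_list (take i t) a"
  using assms
proof (induction j rule: dec_induct)
  case (step j)
  then show ?case by (simp add: count_take_Suc)
qed simp

context
  fixes t :: "letter list"
  assumes alt: "alternating (Sig # t @ [Sig])" and Sig: "Sig \<notin> set t"
begin

lemma nth_framed: "i < length t \<Longrightarrow> (Sig # t @ [Sig]) ! Suc i = t ! i"
  by (simp add: nth_append)

lemma nth_neq_Sig: "i < length t \<Longrightarrow> t ! i \<noteq> Sig"
  using Sig by (metis nth_mem)

text \<open>Passing from one \<open>x\<close> to the next flips the parity of the index and of the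
  count; the first \<open>x\<close> has odd distance to the leading \<open>Sig\<close>, hence an
  even index in \<open>t\<close>.\<close>

lemma alternating_parity:
  assumes "i < length t" "t ! i = Prop x"
  shows "even i \<longleftrightarrow> even (count_list (take i t) (Prop x))"
  using assms
proof (induction i rule: less_induct)
  case (less i)
  have x: "Prop x \<in> set (Sig # t @ [Sig])" using less.prems by (metis UnCI nth_mem set_append set_subset_Cons subsetD)
  show ?case
  proof (cases "\<exists>q<i. t ! q = Prop x")
    case True
    then obtain q where q: "q < i" "t ! q = Prop x" "\<And>r. q < r \<Longrightarrow> r < i \<Longrightarrow> t ! r \<noteq> Prop x"
      using last_below[of _ i "\<lambda>q. t ! q = Prop x"] by metis
    have "odd (Suc i - Suc q)"
    proof (rule alternatingD1[OF alt x])
      fix r assume "Suc q < r" "r < Suc i"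
      then show "(Sig # t @ [Sig]) ! r \<notin> {Sig, Prop x}"
        using nth_framed[of "r - 1"] nth_neq_Sig[of "r - 1"] q(3)[of "r - 1"] less.prems(1)
        by (cases r) auto
    qed (use q less.prems in \<open>auto simp: nth_append\<close>)
    then have "odd (i - q)" by simp
    moreover have "count_list (take i t) (Prop x) = Suc (count_list (take q t) (Prop x))"
      using count_take_eq[of "Suc q" i t "Prop x"] count_take_Suc[of q t "Prop x"] q less.prems(1) by simp
    moreover have "even q \<longleftrightarrow> even (count_list (take q t) (Prop x))"
      using less.IH q less.prems(1) by simp
    ultimately show ?thesis using q(1) by auto
  next
    case False
    have "odd (Suc i - 0)"
    proof (rule alternatingD1[OF alt x])
      fix r assume "0 < r" "r < Suc i"
      then show "(Sig # t @ [Sig]) ! r \<notin> {Sig, Prop x}"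
        using nth_framed[of "r - 1"] nth_neq_Sig[of "r - 1"] False less.prems(1)
        by (cases r) auto
    qed (use less.prems in \<open>auto simp: nth_append\<close>)
    then show ?thesis using count_take_eq[of 0 i t "Prop x"] False less.prems(1) by simp
  qed
qed

text \<open>The position \<open>k\<close> says that \<open>x\<close> is met before \<open>y\<close>.
  Between neighbouring occurrences of the two letters the index keeps its parity, and
  \<open>alternating_parity\<close> translates index parities into each letter's own prefix count.
  So an odd count of \<open>x\<close> at a \<open>y\<close> yields an even count of \<open>y\<close>
  at the next \<open>x\<close>, and conversely.\<close>

lemma alternating_order:
  assumes xy: "x \<noteq> y" and k: "k < length t" "t ! k = Prop x" "\<And>r. r < k \<Longrightarrow> t ! r \<noteq> Prop y"
    and "i < length t"
  shows "(t ! i = Prop x \<longrightarrow> even (count_list (take i t) (Prop y))) \<and>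
    (t ! i = Prop y \<longrightarrow> odd (count_list (take i t) (Prop x)))"
  using \<open>i < length t\<close>
proof (induction i rule: less_induct)
  case (less i)
  have "even (count_list (take i t) (Prop y))" if i: "t ! i = Prop x"
  proof (cases "\<exists>q<i. t ! q \<in> {Prop x, Prop y}")
    case True
    then obtain q where q: "q < i" "t ! q \<in> {Prop x, Prop y}"
      "\<And>r. q < r \<Longrightarrow> r < i \<Longrightarrow> t ! r \<notin> {Prop x, Prop y}"
      using last_below[of _ i "\<lambda>q. t ! q \<in> {Prop x, Prop y}"] by metis
    have c: "count_list (take i t) (Prop z) = count_list (take q t) (Prop z) + (if t ! q = Prop z then 1 else 0)"
      if "z \<in> {x, y}" for z
      using count_take_eq[of "Suc q" i t "Prop z"] count_take_Suc[of q t "Prop z"] q(1,3) less.prems that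
      by auto
    from q(2) consider (x) "t ! q = Prop x" | (y) "t ! q = Prop y" by blast
    then show ?thesis
    proof cases
      case x
      then show ?thesis using c[of y] less.IH[of q] q(1) less.prems xy by simp
    next
      case y
      have "even (Suc i - Suc q)"
      proof (rule alternatingD2[OF alt xy[symmetric]])
        fix r assume "Suc q < r" "r < Suc i"
        then show "(Sig # t @ [Sig]) ! r \<notin> {Sig, Prop y, Prop x}"
          using nth_framed[of "r - 1"] nth_neq_Sig[of "r - 1"] q(3)[of "r - 1"] less.prems(1)
          by (cases r) auto
      qed (use q(1) y i less.prems in \<open>auto simp: nth_append\<close>)
      then have "even i \<longleftrightarrow> even q" using q(1) by auto
      moreover have "odd (count_list (take q t) (Prop x))" using less.IH[of q] q(1) y less.prems by simp
      moreover have "even q \<longleftrightarrow> even (count_list (take q t) (Prop y))"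
        using alternating_parity[OF _ y] q(1) less.prems by simp
      moreover have "even i \<longleftrightarrow> even (count_list (take i t) (Prop x))"
        using alternating_parity[OF less.prems i] .
      ultimately show ?thesis using c[of x] c[of y] y xy by auto
    qed
  next
    case False
    then show ?thesis using count_take_eq[of 0 i t "Prop y"] less.prems by auto
  qed
  moreover have "odd (count_list (take i t) (Prop x))" if i: "t ! i = Prop y"
  proof -
    have "k < i" using k(2,3) i xy by (metis letter.inject linorder_neqE_nat)
    then obtain q where q: "q < i" "t ! q \<in> {Prop x, Prop y}"
      "\<And>r. q < r \<Longrightarrow> r < i \<Longrightarrow> t ! r \<notin> {Prop x, Prop y}"
      using last_below[of k i "\<lambda>q. t ! q \<in> {Prop x, Prop y}"] k(2) by blast
    have c: "count_list (take i t) (Prop z) = count_list (take q t) (Prop z) + (if t ! q = Prop z then 1 else 0)"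
      if "z \<in> {x, y}" for z
      using count_take_eq[of "Suc q" i t "Prop z"] count_take_Suc[of q t "Prop z"] q(1,3) less.prems that
      by auto
    from q(2) consider (x) "t ! q = Prop x" | (y) "t ! q = Prop y" by blast
    then show ?thesis
    proof cases
      case y
      then show ?thesis using c[of x] less.IH[of q] q(1) less.prems xy by simp
    next
      case x
      have "even (Suc i - Suc q)"
      proof (rule alternatingD2[OF alt xy])
        fix r assume "Suc q < r" "r < Suc i"
        then show "(Sig # t @ [Sig]) ! r \<notin> {Sig, Prop x, Prop y}"
          using nth_framed[of "r - 1"] nth_neq_Sig[of "r - 1"] q(3)[of "r - 1"] less.prems(1)
          by (cases r) auto
      qed (use q(1) x i less.prems in \<open>auto simp: nth_append\<close>)
      then have "even i \<longleftrightarrow> even q" using q(1) by auto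
      moreover have "even (count_list (take q t) (Prop y))" using less.IH[of q] q(1) x less.prems by simp
      moreover have "even q \<longleftrightarrow> even (count_list (take q t) (Prop x))"
        using alternating_parity[OF _ x] q(1) less.prems by simp
      moreover have "even i \<longleftrightarrow> even (count_list (take i t) (Prop y))"
        using alternating_parity[OF less.prems i] .
      ultimately show ?thesis using c[of x] c[of y] x xy by auto
    qed
  qed
  ultimately show ?case by blast
qed

lemma alternating_scan:
  "\<exists>h. inj_on h {x. Prop x \<in> set t} \<and> scan {x. Prop x \<in> set t} h 0 (\<lambda>_. 0) t"
proof (intro exI conjI)
  \<comment> \<open>First positions order the letters; a position carries one letter, so
    \<open>h\<close> is injective.\<close>
  define h where "h = (\<lambda>x. LEAST i. i < length t \<and> t ! i = Prop x)"
  have h: "h x < length t \<and> t ! h x = Prop x" if "Prop x \<in> set t" for x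
    unfolding h_def using that LeastI_ex[of "\<lambda>i. i < length t \<and> t ! i = Prop x"]
    by (metis in_set_conv_nth)
  have h_le: "h x \<le> i" if "i < length t" "t ! i = Prop x" for i x
    unfolding h_def using that by (intro Least_le) simp
  show inj: "inj_on h {x. Prop x \<in> set t}"
    by (rule inj_onI) (metis h letter.inject mem_Collect_eq)
  show "scan {x. Prop x \<in> set t} h 0 (\<lambda>_. 0) t"
    unfolding scan_iff_nth
  proof (intro allI impI conjI ballI)
    fix i x assume i: "i < length t" "t ! i = Prop x"
    show "even (0 + i) \<longleftrightarrow> even (0 + count_list (take i t) (Prop x))"
      using alternating_parity[OF i] by simp
  next
    fix i x y assume i: "i < length t" "t ! i = Prop x" and y: "y \<in> {x. Prop x \<in> set t} - {x}"
    have x: "Prop x \<in> set t" using i by (metis nth_mem)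
    have first: "t ! r \<noteq> Prop z" if "r < h z'" "h z' < h z" "Prop z' \<in> set t" for r z z'
      using h_le[of r z] h[OF that(3)] that by auto
    consider "h y < h x" | "h x < h y" using inj x y by (metis DiffE inj_onD linorder_neqE_nat mem_Collect_eq singletonI)
    then show "odd (0 + count_list (take i t) (Prop y)) \<longleftrightarrow> h y < h x"
    proof cases
      case 1
      then show ?thesis using alternating_order[of y x "h y" i] h[of y] y i first[OF _ 1] by auto
    next
      case 2
      then show ?thesis using alternating_order[of x y "h x" i] h[of x] x y i first[OF _ 2] by auto
    qed
  qed
qed

end

lemma graph_word_alternating:
  assumes sun: "sunoid V E cs" and lab: "inj_on lab (inscribed V E)"
    and gw: "graph_word V E cs lab = g1 @ Sig # g2"
  shows "alternating (Sig # (g2 @ g1) @ [Sig])" "Sig \<notin> set (g2 @ g1)"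
proof -
  let ?I = "inscribed V E" and ?N = "length cs" and ?l = "vlabel V E lab" and ?i = "length g1"
  \<comment> \<open>\<open>F j\<close> is the vertex \<open>j\<close> steps after the chosen one
    labelled \<open>Sig\<close>; \<open>F ?N\<close> is that vertex again and matches the closing
    \<open>Sig\<close> of \<open>w\<close>.\<close>
  define F where "F j = rimv cs ?i j" for j
  define w where "w = Sig # (g2 @ g1) @ [Sig]"
  have ms: "multisun V E cs" using sun unfolding sunoid_def by blast
  note msD = multisunD[OF ms]
  have finI: "finite ?I"
    by (rule finite_subset[of _ "Pow V"]) (use msD(1) in \<open>auto simp: inscribed_def maxclique_def clique_def\<close>)
  have N: "?N = Suc (length g1 + length g2)"
    using arg_cong[OF gw, of length] by (simp add: graph_word_def)
  have lenw: "length w = Suc ?N" by (simp add: w_def N)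
  have i: "?i < ?N" and N_pos: "0 < ?N" using N by linarith+
  have rot: "rotate ?i (map ?l cs) = Sig # g2 @ g1"
    using gw by (simp add: graph_word_def rotate_append)
  have wF: "w ! j = ?l (F j)" if "j \<le> ?N" for j
  proof (cases "j = ?N")
    case True
    have "?l (cs ! ?i) = Sig"
      using arg_cong[OF gw, of "\<lambda>u. u ! ?i"] i by (simp add: graph_word_def)
    moreover have "F ?N = cs ! ?i" using i by (simp add: F_def rimv_def)
    moreover have "w ! ?N = Sig" by (simp add: w_def N nth_append)
    ultimately show ?thesis using True by simp
  next
    case False
    then have j: "j < ?N" using that by simp
    have "w ! j = (Sig # g2 @ g1) ! j"
      using j N by (auto simp: w_def nth_append nth_Cons split: nat.split)
    also have "\<dots> = ?l (F j)"
      unfolding rot[symmetric] using j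
      by (subst nth_rotate) (use j in \<open>simp_all add: F_def rimv_def nth_map[OF mod_less_divisor[OF N_pos]]\<close>)
    finally show ?thesis .
  qed
  have F0: "?l (F 0) = Sig" using wF[of 0] by (simp add: w_def)
  then have card0: "2 \<le> card {K \<in> ?I. F 0 \<in> K}"
    unfolding vlabel_def Let_def by (auto split: if_splits)
  \<comment> \<open>A vertex labelled \<open>Sig\<close> forces two inscribed cliques, and then the
    vertex shared by all of them has the label \<open>Sig\<close> and not a proper letter.\<close>
  then have cardI: "2 \<le> card ?I"
    using card_mono[OF finI, of "{K \<in> ?I. F 0 \<in> K}"] by auto
  then have Ine: "?I \<noteq> {}" by auto
  have fam: "N_family cs T" if "T \<subseteq> ?I" "T \<noteq> {}" for T
    using sun that unfolding sunoid_iff[OF Ine] by blast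
  obtain \<xi> where xi: "N3 cs ?I \<xi>" using fam[of ?I] Ine unfolding N_family_def by blast
  have xi_in: "\<xi> \<in> A" if "A \<in> ?I" for A using xi that unfolding N3_def by blast
  have disj: "v = \<xi>" if "A \<in> ?I" "B \<in> ?I" "A \<noteq> B" "v \<in> A" "v \<in> B" for A B v
    using xi that unfolding N3_def by blast
  have single: "{K \<in> ?I. v \<in> K} = {A}" if "A \<in> ?I" "v \<in> A" "v \<noteq> \<xi>" for v A
    using that disj by blast
  have lab_xi: "?l \<xi> = Sig"
  proof -
    have "{K \<in> ?I. \<xi> \<in> K} = ?I" using xi_in by blast
    then show ?thesis using cardI by (simp add: vlabel_def Let_def)
  qed
  have lab_A: "?l v = Prop (lab A)" if "A \<in> ?I" "v \<in> A" "v \<noteq> \<xi>" for v A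
    using single[OF that] by (simp add: vlabel_def Let_def)
  have lab_Eps: "?l v = Eps" if "\<And>A. A \<in> ?I \<Longrightarrow> v \<notin> A" for v
  proof -
    have "{K \<in> ?I. v \<in> K} = {}" using that by blast
    then show ?thesis by (simp only: vlabel_def Let_def card.empty) simp
  qed
  have in_A: "v \<in> A \<longleftrightarrow> ?l v \<in> {Sig, Prop (lab A)}" if A: "A \<in> ?I" for v A
  proof (cases "v = \<xi>")
    case False
    show ?thesis
    proof (cases "\<exists>B\<in>?I. v \<in> B")
      case True
      then obtain B where B: "B \<in> ?I" "v \<in> B" by blast
      then have "?l v = Prop (lab B)" using lab_A False by blast
      moreover have "lab A = lab B \<longleftrightarrow> A = B" using A B lab by (auto dest: inj_onD)
      ultimately show ?thesis using disj[of A B v] A B False by auto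
    next
      case False
      then show ?thesis using A lab_Eps[of v] by auto
    qed
  qed (use xi_in[OF A] lab_xi in auto)
  have lab_Sig: "?l v = Sig \<longleftrightarrow> v = \<xi>" for v
    using lab_xi lab_A lab_Eps by (metis letter.distinct(1,3,5))
  have lab_Prop: "\<exists>A\<in>?I. v \<in> A \<and> lab A = x" if "?l v = Prop x" for v x
    using that lab_A lab_Eps lab_xi by (metis letter.distinct(3,5) letter.inject letter.distinct(1))
  have F_eq: "F j = \<xi> \<longleftrightarrow> j = 0" if "j < ?N" for j
  proof -
    have "F 0 = \<xi>" using F0 lab_Sig by blast
    moreover have "F j \<noteq> F 0" if "j \<noteq> 0"
    proof -
      have "(?i + j) mod ?N \<noteq> ?i"
        using i \<open>j < ?N\<close> that by (cases "?i + j < ?N") (auto simp: mod_if)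
      moreover have "(?i + j) mod ?N < ?N" by (rule mod_less_divisor[OF N_pos])
      ultimately show ?thesis using msD(7) i
        by (simp add: F_def rimv_def nth_eq_iff_index_eq)
    qed
    ultimately show ?thesis by auto
  qed
  have rimF: "rimv cs ((?i + p) mod ?N) j = F (p + j)" for p j
    by (simp add: F_def rimv_def mod_add_left_eq add.assoc)
  have Sig_pos: "r = 0 \<or> r = ?N" if "w ! r = Sig" "r \<le> ?N" for r
    using that wF[of r] lab_Sig[of "F r"] F_eq[of r] by (cases "r = ?N") auto
  show "Sig \<notin> set (g2 @ g1)"
  proof
    assume "Sig \<in> set (g2 @ g1)"
    then obtain r where r: "r < length (g2 @ g1)" "(g2 @ g1) ! r = Sig" by (metis in_set_conv_nth)
    then have "w ! Suc r = Sig"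
      unfolding w_def nth_Cons_Suc by (subst nth_append) simp
    then show False using Sig_pos[of "Suc r"] r(1) N by simp
  qed
  have "alternating w" unfolding alternating_def
  proof (intro conjI allI impI; elim conjE)
    fix x p q
    assume a: "Prop x \<in> set w" "p < q" "q < length w" "w ! p \<in> {Sig, Prop x}"
      "w ! q \<in> {Sig, Prop x}" "\<forall>r. p < r \<and> r < q \<longrightarrow> w ! r \<notin> {Sig, Prop x}"
    from a(1) obtain r where r: "r < length w" "w ! r = Prop x" by (metis in_set_conv_nth)
    have "w ! 0 = Sig" "w ! ?N = Sig" using wF[of 0] F0 lenw by (simp_all add: w_def N nth_append)
    then have r0: "0 < r" "r < ?N" using r lenw by (auto simp: less_Suc_eq intro: gr0I)
    obtain A where A: "A \<in> ?I" "lab A = x" using lab_Prop[of "F r" x] wF[of r] r r0 by auto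
    \<comment> \<open>\<open>rim_path\<close> allows at most \<open>?N\<close> vertices, so the
      interval must not be the whole frame; it is not, because \<open>x\<close> occurs strictly
      inside the frame.\<close>
    have "q - p < ?N"
    proof (rule ccontr)
      assume "\<not> q - p < ?N"
      then have "p = 0" "q = ?N" using a(2,3) lenw by linarith+
      then show False using a(6) r0 r(2) by auto
    qed
    have "rim_path cs {A} A A ((?i + p) mod ?N) (Suc (q - p))"
      unfolding rim_path_def rimF
      using a i A \<open>q - p < ?N\<close> lenw in_A[OF A(1)] wF mod_less_divisor[OF N_pos] by auto
    then have "even (Suc (q - p))"
      using fam[of "{A}"] A(1) unfolding N_family_def N1_def by blast
    then show "odd (q - p)" by simp
  next
    fix x y p q
    assume a: "x \<noteq> y" "p < q" "q < length w" "w ! p = Prop x" "w ! q = Prop y"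
      "\<forall>r. p < r \<and> r < q \<longrightarrow> w ! r \<notin> {Sig, Prop x, Prop y}"
    obtain A where A: "A \<in> ?I" "lab A = x" using lab_Prop[of "F p" x] wF[of p] a lenw by auto
    obtain B where B: "B \<in> ?I" "lab B = y" using lab_Prop[of "F q" y] wF[of q] a lenw by auto
    have "p \<noteq> 0" using a(4) by (cases p) (simp_all add: w_def)
    then have "q - p < ?N" using a(2,3) lenw by linarith
    have "rim_path cs {A, B} (A - B) (B - A) ((?i + p) mod ?N) (Suc (q - p))"
      unfolding rim_path_def rimF
      using a i A B \<open>q - p < ?N\<close> lenw in_A[OF A(1)] in_A[OF B(1)] wF mod_less_divisor[OF N_pos] by auto
    moreover have "N5 cs {A, B}" using fam[of "{A, B}"] A(1) B(1) unfolding N_family_def by blast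
    moreover have "A \<noteq> B" using A B a(1) by blast
    ultimately have "odd (Suc (q - p))" unfolding N5_def by (meson insertI1 insertI2)
    then show "even (q - p)" by simp
  qed
  then show "alternating (Sig # (g2 @ g1) @ [Sig])" by (simp add: w_def)
qed

section \<open>Cutting a cyclic word at \<open>Sig\<close>\<close>

lemma rotate_Sig_unique:
  assumes "p1 @ Sig # p2 = rotate k (Sig # b)" "Sig \<notin> set b"
  shows "b = p2 @ p1"
proof -
  define m where "m = (length p1 + k) mod length (Sig # b)"
  have m: "m < length (Sig # b)" unfolding m_def by (rule mod_less_divisor) simp
  have e: "Sig # p2 @ p1 = rotate m (Sig # b)"
    using arg_cong[OF assms(1), of "rotate (length p1)"]
    unfolding m_def rotate_conv_mod[symmetric] by (simp add: rotate_append rotate_rotate)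
  \<comment> \<open>Any other rotation brings a letter of \<open>b\<close> to the front, and
    \<open>b\<close> has no \<open>Sig\<close>.\<close>
  have "m = 0"
  proof (rule ccontr)
    assume "m \<noteq> 0"
    moreover have "(Sig # b) ! m = Sig"
      using arg_cong[OF e, of "\<lambda>u. u ! 0"] m nth_rotate[of 0 "Sig # b" m] by simp
    ultimately show False using assms(2) m by (cases m) (auto dest: nth_mem)
  qed
  then show ?thesis using e by simp
qed

lemma blocks_word_props:
  assumes "\<forall>b\<in>set bs. snd b > 0"
  shows "\<not> has_EpsEps (blocks_word bs)" "Sig \<notin> set (blocks_word bs)"
    "{x. Prop x \<in> set (blocks_word bs)} = letters bs"
    "bs \<noteq> [] \<Longrightarrow> blocks_word bs \<noteq> [] \<and> hd (blocks_word bs) \<noteq> Eps"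
  using assms
proof (induction bs rule: blocks_word.induct)
  have rep: "\<not> has_EpsEps (replicate l (Prop x) @ u)" if "\<not> has_EpsEps u" for l x u
    using that by (induction l) auto
  {
    case (2 x l)
    case 1
    show ?case using rep[of "[]"] by simp
  next
    case (2 x l)
    case 2
    show ?case by simp
  next
    case (2 x l)
    case 3
    then show ?case by (auto simp: letters_def)
  next
    case (2 x l)
    case 4
    then show ?case by (cases l) auto
  next
    case (3 x l b r)
    case 1
    then show ?case using 3 by (auto intro!: rep)
  next
    case (3 x l b r)
    case 2
    then show ?case using 3 by auto
  next
    case (3 x l b r)
    case 3
    then show ?case using "3.IH"(3) by (auto simp: letters_def)
  next
    case (3 x l b r)
    case 4
    then show ?case by (cases l) auto
  }
qed (auto simp: letters_def)

theorem sunword_scan: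
  assumes "sword_blocks bs" "sunword (sword_of bs)"
  shows "\<exists>h. inj_on h (letters bs) \<and> scan (letters bs) h 0 (\<lambda>_. 0) (blocks_word bs)"
proof -
  have pos: "\<forall>b\<in>set bs. snd b > 0" using assms(1) by (simp add: sword_blocks_def)
  note bw = blocks_word_props[OF pos]
  let ?b = "blocks_word bs"
  from assms(2) obtain V E cs lab where sun: "sunoid V E cs" "inj_on lab (inscribed V E)"
    and sim: "word_sim (red (graph_word V E cs lab)) (red (sword_of bs))"
    unfolding sunword_def word_approx_def pattern_eq_red by blast
  let ?g = "graph_word V E cs lab"
  have red_b: "red ?b = ?b" using red_id bw(1) .
  then have sw: "red (sword_of bs) = Sig # ?b" by (simp add: sword_of_def)
  obtain k where k: "red ?g = rotate k (Sig # ?b) \<or> red ?g = rev (rotate k (Sig # ?b))"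
    using sim sw unfolding word_sim_def by auto
  \<comment> \<open>Similarity forces some rim vertex to carry \<open>Sig\<close>, which rules out a
    sunoid with a single inscribed clique.\<close>
  then have "Sig \<in> set (red ?g)" by auto
  then obtain g1 g2 where g: "?g = g1 @ Sig # g2"
    using in_set_red[of Sig ?g] by (auto dest: split_list)
  note alt = graph_word_alternating[OF sun g]
  have rg: "red ?g = red g1 @ Sig # red g2" using g red_append_Sig by simp
  have "\<exists>t. alternating (Sig # t @ [Sig]) \<and> Sig \<notin> set t \<and> red t = ?b"
    using k
  proof
    assume "red ?g = rotate k (Sig # ?b)"
    then have "?b = red g2 @ red g1" using rotate_Sig_unique bw(2) rg by metis
    then have "red (g2 @ g1) = ?b" using red_red_append red_b by metis
    then show ?thesis using alt by blast
  next
    assume "red ?g = rev (rotate k (Sig # ?b))"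
    then have "rev (red g2) @ Sig # rev (red g1) = rotate k (Sig # ?b)"
      using rg by (metis append.assoc append_Cons append_Nil rev.simps(2) rev_append rev_rev_ident)
    then have "?b = rev (red g1) @ rev (red g2)" using rotate_Sig_unique bw(2) by metis
    then have "?b = red (rev g1) @ red (rev g2)" by (simp add: red_rev)
    then have "red (rev (g2 @ g1)) = ?b" using red_red_append red_b by (metis rev_append)
    moreover have "alternating (Sig # rev (g2 @ g1) @ [Sig])"
      using alternating_rev[OF alt(1)] by simp
    ultimately show ?thesis using alt(2) by (metis set_rev)
  qed
  then obtain t where t: "alternating (Sig # t @ [Sig])" "Sig \<notin> set t" "red t = ?b" by blast
  have "{x. Prop x \<in> set t} = letters bs"
    using in_set_red[of "Prop _" t] t(3) bw(3) by auto
  then show ?thesis using alternating_scan[OF t(1,2)] scan_red[of _ _ _ _ t] t(3) by metis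
qed

section \<open>From a word to a sunoid\<close>

text \<open>The positions of \<open>v\<close> are to be the rim vertices and position 0 the common
  vertex. \<open>spaced\<close> separates clique vertices on the rim, even counts give odd cliques
  once position 0 is added, and two letters put position 0 into two cliques.\<close>

locale balanced_word =
  fixes v :: "letter list" and h :: "nat \<Rightarrow> nat" and N :: nat and L :: "nat set"
  defines "N \<equiv> length v" and "L \<equiv> {x. Prop x \<in> set v}"
  assumes v_ne: "v \<noteq> []" and hd_v: "hd v = Sig" and tl_v: "Sig \<notin> set (tl v)"
    and odd_N: "odd N"
    and spaced: "i < N \<Longrightarrow> v ! i \<noteq> Eps \<Longrightarrow> v ! ((i + 1) mod N) = Eps"
    and even_count: "even (count_list v (Prop x))"
    and inj_h: "inj_on h L"
    and scan_v: "scan L h 0 (\<lambda>_. 0) (tl v)"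
    and two_letters: "card L \<ge> 2"
begin

definition A :: "nat \<Rightarrow> nat set" where
  "A x = insert 0 {p. p < N \<and> v ! p = Prop x}"

definition cnt :: "nat \<Rightarrow> nat \<Rightarrow> nat" where
  "cnt x p = count_list (take p v) (Prop x)"

definition s :: "nat \<Rightarrow> nat" where
  "s p = (p + 1) mod N"

definition E :: "nat \<Rightarrow> nat \<Rightarrow> bool" where
  "E p q \<longleftrightarrow> p < N \<and> q < N \<and> p \<noteq> q \<and> (q = s p \<or> p = s q \<or> (\<exists>x\<in>L. p \<in> A x \<and> q \<in> A x))"

lemma N_pos: "0 < N"
  using v_ne by (simp add: N_def)

lemma finite_L: "finite L"
proof -
  have "Prop ` L \<subseteq> set v" by (auto simp: L_def)
  then have "finite (Prop ` L)" by (rule finite_subset) simp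
  then show ?thesis by (rule finite_imageD) (simp add: inj_on_def)
qed

lemma v_0: "v ! 0 = Sig"
  using v_ne hd_v by (simp add: hd_conv_nth)

lemma v_neq_Sig:
  assumes "0 < p" "p < N"
  shows "v ! p \<noteq> Sig"
proof -
  have "p - 1 < length (tl v)" using assms unfolding N_def length_tl by linarith
  then have "tl v ! (p - 1) \<in> set (tl v)" "tl v ! (p - 1) = v ! Suc (p - 1)"
    by (rule nth_mem, rule nth_tl)
  moreover have "Suc (p - 1) = p" using assms(1) by simp
  ultimately show ?thesis using tl_v by metis
qed

lemma pos_of_Prop: "p < N \<Longrightarrow> v ! p = Prop x \<Longrightarrow> 0 < p"
  using v_0 by (cases p) auto

lemma Prop_in_L: "p < N \<Longrightarrow> v ! p = Prop x \<Longrightarrow> x \<in> L"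
  unfolding L_def N_def using nth_mem by force

lemma s_eq: "p < N \<Longrightarrow> s p = (if Suc p = N then 0 else Suc p)"
  by (simp add: s_def)

lemma s_less: "s p < N"
  using N_pos by (simp add: s_def)

lemma cnt_tl:
  assumes "0 < p" "p < N"
  shows "count_list (take (p - 1) (tl v)) (Prop x) = cnt x p"
proof -
  have "v = Sig # tl v" using v_ne hd_v by (metis list.collapse)
  then have "take p v = Sig # take (p - 1) (tl v)" using assms(1) by (cases p) (simp, metis diff_Suc_1 take_Suc_Cons)
  then show ?thesis by (simp add: cnt_def)
qed

text \<open>Indices of \<open>v\<close> exceed those of \<open>tl v\<close> by one, because of the
  leading \<open>Sig\<close>; hence the index parity is opposite to the one in
  \<open>scan\<close>.\<close>

lemma cnt_parity:
  assumes "p < N" "v ! p = Prop x"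
  shows "even p \<longleftrightarrow> odd (cnt x p)"
    and "y \<in> L \<Longrightarrow> y \<noteq> x \<Longrightarrow> odd (cnt y p) \<longleftrightarrow> h y < h x"
proof -
  have p: "0 < p" using pos_of_Prop assms by blast
  have i: "p - 1 < length (tl v)" "tl v ! (p - 1) = Prop x"
    using p assms by (simp_all add: N_def nth_tl)
  note sc = scan_v[unfolded scan_iff_nth, rule_format, OF i]
  show "even p \<longleftrightarrow> odd (cnt x p)"
    using sc[THEN conjunct1] p cnt_tl[OF p assms(1)] by auto
  show "odd (cnt y p) \<longleftrightarrow> h y < h x" if "y \<in> L" "y \<noteq> x"
    using sc[THEN conjunct2, THEN bspec, of y] that cnt_tl[OF p assms(1), of y] by simp
qed

lemma cnt_step:
  assumes "p < q" "q \<le> N" "\<And>r. p < r \<Longrightarrow> r < q \<Longrightarrow> v ! r \<noteq> Prop x"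
  shows "cnt x q = cnt x p + (if v ! p = Prop x then 1 else 0)"
  using count_take_eq[of "Suc p" q v "Prop x"] count_take_Suc[of p v "Prop x"] assms
  by (simp add: cnt_def N_def)

lemma cnt_N: "even (cnt x N)"
  using even_count by (simp add: cnt_def N_def)

text \<open>At occurrences of \<open>x\<close> an even index goes with an odd count. The same holds
  at \<open>q = N\<close>, the return to the common vertex, since \<open>N\<close> is odd and the
  total count even; the start \<open>p = 0\<close> contributes nothing to the count.\<close>

lemma gap_same:
  assumes pq: "p < q" "q \<le> N" and p: "p \<in> A x" and q: "q = N \<or> v ! q = Prop x"
    and between: "\<And>r. p < r \<Longrightarrow> r < q \<Longrightarrow> v ! r \<noteq> Prop x"
  shows "odd (q - p)"
proof -
  have step: "cnt x q = cnt x p + (if v ! p = Prop x then 1 else 0)"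
    using cnt_step pq between by blast
  have q': "even q \<longleftrightarrow> odd (cnt x q)"
    using q cnt_N[of x] odd_N cnt_parity(1)[of q x] pq(2) by (cases "q = N") auto
  have "odd q \<longleftrightarrow> even p"
  proof (cases "p = 0")
    case True
    then show ?thesis using step v_0 q' by (simp add: cnt_def)
  next
    case False
    then have "p < N" "v ! p = Prop x" using p by (auto simp: A_def)
    then show ?thesis using cnt_parity(1)[of p x] step q' by simp
  qed
  then show ?thesis using pq(1) by auto
qed

text \<open>The count of \<open>x\<close> rises by one and that of \<open>y\<close> stays, so the
  conditions at the two ends make \<open>even p\<close> as well as \<open>even q\<close> equivalent
  to \<open>h y < h x\<close>.\<close>

lemma gap_different:
  assumes "x \<noteq> y" "p < q" "q < N" "v ! p = Prop x" "v ! q = Prop y"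
    "\<And>r. p < r \<Longrightarrow> r < q \<Longrightarrow> v ! r \<noteq> Prop x \<and> v ! r \<noteq> Prop y"
  shows "even (q - p)"
proof -
  have L: "x \<in> L" "y \<in> L" using Prop_in_L assms by (meson less_trans)+
  have p: "p < N" using assms by simp
  have h: "h x \<noteq> h y" using inj_h L assms(1) by (auto dest: inj_onD)
  have "cnt x q = Suc (cnt x p)" "cnt y q = cnt y p"
    using cnt_step[of p q] assms by simp_all
  then show ?thesis
    using cnt_parity(1)[OF p assms(4)] cnt_parity(2)[OF p assms(4) L(2)]
      cnt_parity(1)[OF assms(3,5)] cnt_parity(2)[OF assms(3,5) L(1)] assms(1,2) h
    by (auto simp: not_less)
qed

lemma A_D: "p \<in> A x \<Longrightarrow> p < N \<and> v ! p \<noteq> Eps"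
  using v_0 N_pos by (auto simp: A_def)

lemma zero_in_A: "0 \<in> A x"
  by (simp add: A_def)

lemma A_disjoint: "x \<noteq> y \<Longrightarrow> p \<in> A x \<Longrightarrow> p \<in> A y \<Longrightarrow> p = 0"
  by (auto simp: A_def)

lemma A_not_consecutive: "p \<in> A x \<Longrightarrow> s p \<in> A y \<Longrightarrow> False"
  using A_D[of p x] A_D[of "s p" y] spaced[of p] by (simp add: s_def)

text \<open>Two vertices of one clique with a single blank between them would have an even gap. This
  excludes triangles of two rim edges and one clique edge.\<close>

lemma A_not_distance_two:
  assumes "p \<in> A x" "s (s p) \<in> A x"
  shows False
proof -
  have p: "p < N" "v ! p \<noteq> Eps" using A_D[OF assms(1)] by auto
  have "Suc p < N"
    using A_not_consecutive[OF assms(1), of x] p zero_in_A[of x]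
    by (cases "Suc p = N") (auto simp: s_eq)
  then have sp: "s p = Suc p" using p by (simp add: s_eq)
  have "v ! Suc p = Eps" using spaced[OF p] \<open>Suc p < N\<close> by simp
  have "odd (Suc (Suc p) - p)"
  proof (rule gap_same[OF _ _ assms(1)])
    show "Suc (Suc p) = N \<or> v ! Suc (Suc p) = Prop x"
      using assms(2) \<open>Suc p < N\<close> unfolding sp by (auto simp: s_eq A_def split: if_splits)
  next
    fix r assume "p < r" "r < Suc (Suc p)"
    then have "r = Suc p" by simp
    then show "v ! r \<noteq> Prop x" using \<open>v ! Suc p = Eps\<close> by simp
  qed (use \<open>Suc p < N\<close> in simp_all)
  then show False by simp
qed

lemma letter_position:
  assumes "x \<in> L"
  obtains p where "p \<in> A x" "1 < p" "p < N" "v ! p = Prop x"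
proof -
  obtain p where p: "p < N" "v ! p = Prop x"
    using assms unfolding L_def N_def by (metis in_set_conv_nth mem_Collect_eq)
  have "0 < p" using pos_of_Prop p by blast
  moreover have "p \<noteq> 1"
    using spaced[OF N_pos] v_0 p by auto
  ultimately show thesis using that[of p] p by (simp add: A_def)
qed

lemma L_two: "\<exists>x\<in>L. \<exists>y\<in>L. x \<noteq> y"
  using two_letters card_le_Suc0_iff_eq[OF finite_L] by fastforce

lemma N_ge: "N > 3"
proof -
  obtain x y where xy: "x \<in> L" "y \<in> L" "x \<noteq> y" using L_two by blast
  obtain p where p: "1 < p" "p < N" "v ! p = Prop x" using letter_position[OF xy(1)] by metis
  obtain q where q: "1 < q" "q < N" "v ! q = Prop y" using letter_position[OF xy(2)] by metis
  have "p \<noteq> q" using p q xy by auto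
  then show ?thesis using p q by linarith
qed

section \<open>Cliques of the constructed graph\<close>

lemma E_sym: "E p q \<Longrightarrow> E q p"
  by (auto simp: E_def)

text \<open>By the number of rim sides of such a triangle: three would need \<open>N = 3\<close>,
  two put vertices of one clique at distance two, and one makes clique vertices consecutive.\<close>

lemma no_rim_triangle:
  assumes "p < N" "r \<noteq> p" "r \<noteq> s p" "E p r" "E (s p) r"
  shows False
proof -
  have r: "r < N" using assms by (simp add: E_def)
  consider "p = s r" | x where "x \<in> L" "p \<in> A x" "r \<in> A x"
    using assms(3,4) by (auto simp: E_def)
  then show False
  proof cases
    case 1
    consider "r = s (s p)" | "s p = s r" | x where "x \<in> L" "s p \<in> A x" "r \<in> A x"
      using assms(5) by (auto simp: E_def)
    then show False
    proof cases
      case 2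
      then show False using assms(1,2) r by (auto simp: s_eq split: if_splits)
    next
      case 3
      then show False using A_not_distance_two[of r x] 1 by simp
    qed (use 1 N_ge r assms in \<open>auto simp: s_eq s_less split: if_splits\<close>)
  next
    case 2
    consider "r = s (s p)" | "s p = s r" | y where "y \<in> L" "s p \<in> A y" "r \<in> A y"
      using assms(5) by (auto simp: E_def)
    then show False
    proof cases
      case 1
      then show False using 2 A_not_distance_two by blast
    next
      case 2
      then show False using assms(1,2) r by (auto simp: s_eq split: if_splits)
    next
      case 3
      then show False using 2 A_not_consecutive by blast
    qed
  qed
qed

text \<open>All three sides lie in sets \<open>A\<close>, and at least one of \<open>p\<close>,
  \<open>q\<close> is not the common vertex 0; the two sides meeting there belong to the same set,
  which then contains all three vertices.\<close>

lemma triangle: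
  assumes "p \<noteq> q" "q \<noteq> r" "p \<noteq> r" "E p q" "E q r" "E p r"
  obtains x where "x \<in> L" "p \<in> A x" "q \<in> A x" "r \<in> A x"
proof -
  have lt: "p < N" "q < N" "r < N" using assms by (auto simp: E_def)
  have nonrim: "b \<noteq> s a" if "E a c" "E b c" "a < N" "a \<noteq> c" "b \<noteq> c" for a b c
    using no_rim_triangle[of a c] that by blast
  note Es = assms(4-6) assms(4-6)[THEN E_sym]
  have "q \<noteq> s p" "p \<noteq> s q" "r \<noteq> s q" "q \<noteq> s r" "r \<noteq> s p" "p \<noteq> s r"
    using nonrim[of p r q] nonrim[of q r p] nonrim[of q p r] nonrim[of r p q]
      nonrim[of p q r] nonrim[of r q p] lt Es assms(1-3) by auto
  then obtain x y z where "x \<in> L" "p \<in> A x" "q \<in> A x" "y \<in> L" "q \<in> A y" "r \<in> A y"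
    "z \<in> L" "p \<in> A z" "r \<in> A z"
    using assms(4-6) by (auto simp: E_def)
  then show thesis using that A_disjoint[of x y q] A_disjoint[of x z p] assms(1) by metis
qed

lemma rim_edge: "p < N \<Longrightarrow> E p (s p)"
  using N_ge s_less[of p] by (auto simp: E_def s_eq)

lemma clique_A: "x \<in> L \<Longrightarrow> clique {..<N} E (A x)"
  using A_D by (auto simp: clique_def E_def)

lemma maxclique_A:
  assumes "x \<in> L"
  shows "maxclique {..<N} E (A x)"
  unfolding maxclique_def
proof (intro conjI allI impI; (elim conjE)?)
  show "clique {..<N} E (A x)" using clique_A[OF assms] .
  fix K assume K: "clique {..<N} E K" "A x \<subseteq> K"
  obtain p where p: "p \<in> A x" "1 < p" using letter_position[OF assms] by metis
  have "r \<in> A x" if "r \<in> K" for r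
  proof (rule ccontr)
    assume r: "r \<notin> A x"
    then have "r \<noteq> 0" "r \<noteq> p" using zero_in_A[of x] p(1) by metis+
    then have "E p 0" "E 0 r" "E p r"
      using K that p zero_in_A[of x] unfolding clique_def by (simp_all add: subset_eq)
    then obtain y where "y \<in> L" "p \<in> A y" "0 \<in> A y" "r \<in> A y"
      using triangle[of p 0 r] p(2) \<open>r \<noteq> 0\<close> \<open>r \<noteq> p\<close> by auto
    then have "y = x" using A_disjoint[of x y p] p by auto
    then show False using r \<open>r \<in> A y\<close> by simp
  qed
  then show "K = A x" using K(2) by blast
qed

lemma maxclique_rim:
  assumes "p < N"
  shows "maxclique {..<N} E {p, s p}"
  unfolding maxclique_def
proof (intro conjI allI impI; (elim conjE)?)
  have E: "E p (s p)" using rim_edge[OF assms] .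
  show "clique {..<N} E {p, s p}"
    using E E_sym[OF E] assms s_less by (auto simp: clique_def)
  fix K assume K: "clique {..<N} E K" "{p, s p} \<subseteq> K"
  have "r \<in> {p, s p}" if "r \<in> K" for r
    using no_rim_triangle[OF assms, of r] K that unfolding clique_def by auto
  then show "K = {p, s p}" using K(2) by blast
qed

lemma maxclique_cases:
  assumes "maxclique {..<N} E K"
  shows "(\<exists>x\<in>L. K = A x) \<or> (\<exists>p<N. K = {p, s p})"
proof -
  have K: "clique {..<N} E K" and max: "\<And>K'. clique {..<N} E K' \<Longrightarrow> K \<subseteq> K' \<Longrightarrow> K' = K"
    using assms by (auto simp: maxclique_def)
  have "\<exists>p\<in>K. \<exists>q\<in>K. p \<noteq> q"
  proof (rule ccontr)
    assume no: "\<not> ?thesis"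
    obtain p where p: "p < N" "K \<subseteq> {p}"
      using no K N_pos unfolding clique_def by (cases "K = {}") blast+
    have "{p, s p} = K"
      using max[of "{p, s p}"] maxclique_rim[OF p(1)] p(2) by (auto simp: maxclique_def)
    then show False using no rim_edge[OF p(1)] by (auto simp: E_def)
  qed
  then obtain p q where pq: "p \<in> K" "q \<in> K" "p \<noteq> q" by blast
  have E: "E p q" using K pq by (simp add: clique_def)
  then have lt: "p < N" "q < N" by (auto simp: E_def)
  have rim: "K = {a, s a}" if "a < N" "a \<in> K" "s a \<in> K" for a
    using maxclique_rim[OF that(1)] K that by (auto simp: maxclique_def)
  consider "q = s p" | "p = s q" | x where "x \<in> L" "p \<in> A x" "q \<in> A x"
    using E by (auto simp: E_def)
  then show ?thesis
  proof cases
    case 3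
    have "r \<in> A x" if "r \<in> K" for r
    proof (cases "r = p \<or> r = q")
      case False
      then have "E q r" "E p r" using K that pq by (auto simp: clique_def)
      then obtain y where "y \<in> L" "p \<in> A y" "q \<in> A y" "r \<in> A y"
        using triangle[of p q r] E pq False by metis
      moreover have "y = x" using A_disjoint[of x y p] A_disjoint[of x y q] 3 calculation pq by auto
      ultimately show ?thesis by simp
    qed (use 3 in auto)
    then have "A x = K" using max[OF clique_A[OF 3(1)]] by blast
    then show ?thesis using 3 by blast
  qed (use rim[of p] rim[of q] lt pq in auto)
qed

lemma card_A: "odd (card (A x))"
proof -
  have "card {p. p < N \<and> v ! p = Prop x} = count_list v (Prop x)"
    unfolding N_def by (simp add: count_list_eq_length_filter length_filter_conv_card eq_commute)
  moreover have "card (A x) = Suc (card {p. p < N \<and> v ! p = Prop x})"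
    unfolding A_def by (rule card_insert_disjoint) (use v_0 in auto)
  ultimately show ?thesis using even_count by simp
qed

lemma card_rim: "p < N \<Longrightarrow> card {p, s p} = 2"
  using rim_edge[of p] by (simp add: E_def)

lemma inscribed_eq: "inscribed {..<N} E = A ` L"
proof -
  have "card (A x) \<noteq> 2" for x using card_A[of x] by fastforce
  then show ?thesis
    unfolding inscribed_def using maxclique_cases card_rim maxclique_A by blast
qed

lemma inj_A: "inj_on A L"
proof (rule inj_onI)
  fix x y assume "x \<in> L" "y \<in> L" and e: "A x = A y"
  obtain p where "p \<in> A x" "1 < p" using letter_position[OF \<open>x \<in> L\<close>] by metis
  then show "x = y" using A_disjoint[of x y p] e by auto
qed

lemma multisun_E: "multisun {..<N} E [0..<N]"
proof -
  have nth_s: "[0..<N] ! i = i" "[0..<N] ! ((i + 1) mod N) = s i" if "i < N" for i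
    using that s_less[of i] by (simp_all add: s_def)
  have diamond: "no_induced_diamond {..<N} E"
    unfolding no_induced_diamond_def
  proof (rule notI, elim bexE conjE)
    fix a b c d
    assume E: "E a b" "E a c" "E a d" "E b c" "E b d" "\<not> E c d" and "distinct [a, b, c, d]"
      and lt: "c \<in> {..<N}" "d \<in> {..<N}"
    then have ne: "a \<noteq> b" "a \<noteq> c" "a \<noteq> d" "b \<noteq> c" "b \<noteq> d" "c \<noteq> d" by auto
    obtain x where x: "x \<in> L" "a \<in> A x" "b \<in> A x" "c \<in> A x"
      using triangle[of a b c] E ne by metis
    obtain y where y: "y \<in> L" "a \<in> A y" "b \<in> A y" "d \<in> A y"
      using triangle[of a b d] E ne by metis
    have "x = y" using A_disjoint[of x y a] A_disjoint[of x y b] x y ne by auto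
    then show False using x y E ne lt by (auto simp: E_def)
  qed
  have rim: "{K. maxclique {..<N} E K \<and> card K = 2} =
      {{[0..<N] ! i, [0..<N] ! ((i + 1) mod length [0..<N])} | i. i < length [0..<N]}"
    (is "?l = ?r")
  proof -
    have "?r = {{i, s i} | i. i < N}" using nth_s by (metis (no_types, lifting) diff_zero length_upt)
    moreover have "card (A x) \<noteq> 2" for x using card_A[of x] by fastforce
    then have "?l = {{i, s i} | i. i < N}"
      using maxclique_cases card_rim maxclique_rim by blast
    ultimately show ?thesis by simp
  qed
  have "\<not> consecutive [0..<N] p q" if "x \<in> L" "p \<in> A x" "q \<in> A x" for x p q
  proof
    assume "consecutive [0..<N] p q"
    then obtain i where "i < N" "(p = i \<and> q = s i) \<or> (q = i \<and> p = s i)"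
      unfolding consecutive_def using nth_s s_less by auto
    then show False using A_not_consecutive that by blast
  qed
  then show ?thesis
    unfolding multisun_def inscribed_eq rim
    using diamond odd_N N_ge by (auto simp: E_def)
qed

section \<open>Rim paths of the constructed graph\<close>

lemma rimv_upt: "rimv [0..<N] i j = (i + j) mod N"
  using N_pos by (simp add: rimv_def)

text \<open>Position 0 lies in every clique of the nonempty family, so it is never an inner vertex
  and no path runs across it. Wrapping around is reduced to the single end value \<open>N\<close>,
  read as position 0.\<close>

lemma rim_path_linear:
  assumes path: "rim_path [0..<N] (A ` M) P Q i m" and "M \<noteq> {}"
  shows "i < i + (m - 1)" "i + (m - 1) \<le> N"
    and "\<And>r x. i < r \<Longrightarrow> r < i + (m - 1) \<Longrightarrow> x \<in> M \<Longrightarrow> v ! r \<noteq> Prop x"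
proof -
  have inner: "(i + j) mod N \<notin> A x" if "0 < j" "j < m - 1" "x \<in> M" for j x
    using path that unfolding rim_path_def rimv_upt by blast
  have i: "i < N" "2 \<le> m" using path by (auto simp: rim_path_def)
  then show "i < i + (m - 1)" by simp
  show le: "i + (m - 1) \<le> N"
  proof (rule ccontr)
    assume "\<not> ?thesis"
    then have "0 < N - i" "N - i < m - 1" using i by auto
    then show False using inner[of "N - i"] zero_in_A \<open>M \<noteq> {}\<close> i by auto
  qed
  show "v ! r \<noteq> Prop x" if "i < r" "r < i + (m - 1)" "x \<in> M" for r x
  proof
    assume "v ! r = Prop x"
    moreover have "r < N" using that le by simp
    moreover have "0 < r - i" "r - i < m - 1" using that by linarith+
    ultimately show False using inner[of "r - i" x] that by (simp add: A_def)
  qed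
qed

lemma N_family_A:
  assumes "M \<subseteq> L" "M \<noteq> {}"
  shows "N_family [0..<N] (A ` M)"
proof -
  have path: "even m \<and> m \<ge> 4"
    if x: "x \<in> M" and path: "rim_path [0..<N] (A ` M) (A x) (A x) i m" for x i m
  proof -
    note lin = rim_path_linear[OF path assms(2)]
    have ends: "i \<in> A x" "(i + (m - 1)) mod N \<in> A x" "2 \<le> m" "i < N"
      using path unfolding rim_path_def rimv_upt by auto
    have "odd (i + (m - 1) - i)"
    proof (rule gap_same[OF lin(1,2) ends(1)])
      show "i + (m - 1) = N \<or> v ! (i + (m - 1)) = Prop x"
        using ends(2) lin(1,2) by (cases "i + (m - 1) = N") (auto simp: A_def)
    qed (use lin(3) x in blast)
    then have ev: "even m" using ends(3) by auto
    \<comment> \<open>Evenness leaves only 2 below the bound 4, and two vertices would be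
      consecutive.\<close>
    moreover have "m \<noteq> 2"
      using A_not_consecutive[OF ends(1), of x] ends(2) by (auto simp: s_def)
    ultimately show ?thesis using ends(3) by presburger
  qed
  have path2: "odd m"
    if xy: "x \<in> M" "y \<in> M" "x \<noteq> y" and path: "rim_path [0..<N] (A ` M) P Q i m"
      and ends: "(i + 0) mod N \<in> A x - A y" "(i + (m - 1)) mod N \<in> A y - A x" for x y i m P Q
  proof -
    note lin = rim_path_linear[OF path assms(2)]
    have i: "i < N" "2 \<le> m" using path by (auto simp: rim_path_def)
    \<comment> \<open>Position 0 lies in both cliques, hence in neither difference, so the path
      cannot end there.\<close>
    have "i + (m - 1) \<noteq> N" using ends(2) zero_in_A by auto
    then have q: "i + (m - 1) < N" using lin(2) by simp
    have "v ! i = Prop x" "v ! (i + (m - 1)) = Prop y"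
      using ends i q zero_in_A by (auto simp: A_def)
    then have "even (i + (m - 1) - i)"
      using gap_different[OF xy(3) lin(1) q] lin(3) xy by blast
    then show ?thesis using i by auto
  qed
  have "N1 [0..<N] (A ` M)" unfolding N1_def using path by blast
  moreover have "N2 (A ` M)" unfolding N2_def using card_A by blast
  moreover have "N3 [0..<N] (A ` M) 0"
  proof -
    have "A x \<inter> A y = {0}" if "A x \<noteq> A y" for x y
      using that A_disjoint[of x y] zero_in_A by blast
    then show ?thesis using N_pos zero_in_A unfolding N3_def by simp
  qed
  moreover have "N4 [0..<N] (A ` M) 0"
    unfolding N4_def
  proof clarify
    fix x i m assume "x \<in> M" and "rim_path [0..<N] (A ` M) (A x) {0} i m"
    \<comment> \<open>A path to the common vertex is also a path from \<open>A x\<close> to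
      \<open>A x\<close>, so \<open>N4\<close> is inherited from the parity in
      \<open>N1\<close>.\<close>
    then have "rim_path [0..<N] (A ` M) (A x) (A x) i m"
      using zero_in_A unfolding rim_path_def by auto
    then show "even m" using path \<open>x \<in> M\<close> by blast
  qed
  moreover have "N5 [0..<N] (A ` M)"
    unfolding N5_def
  proof (intro ballI impI allI)
    fix P Q i m assume PQ: "P \<in> A ` M" "Q \<in> A ` M" "P \<noteq> Q"
      and "rim_path [0..<N] (A ` M) (P - Q) (Q - P) i m"
    then obtain x y where xy: "x \<in> M" "y \<in> M" "P = A x" "Q = A y"
      and p: "rim_path [0..<N] (A ` M) (A x - A y) (A y - A x) i m" by blast
    then have "x \<noteq> y" using PQ(3) by blast
    \<comment> \<open>\<open>rim_path\<close> leaves open which end lies in which clique, hence the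
      two instances.\<close>
    then show "odd m" using path2[OF xy(1,2) _ p] path2[OF xy(2,1) _ p] p
      unfolding rim_path_def rimv_upt by auto
  qed
  ultimately show ?thesis unfolding N_family_def by blast
qed

lemma sunoid_E: "sunoid {..<N} E [0..<N]"
proof -
  have "inscribed {..<N} E \<noteq> {}" using L_two inscribed_eq by auto
  moreover have "N_family [0..<N] T" if "T \<subseteq> A ` L" "T \<noteq> {}" for T
    using that N_family_A by (auto simp: subset_image_iff)
  ultimately show ?thesis using sunoid_iff multisun_E inscribed_eq by simp
qed

text \<open>\<open>inv_into L A\<close> names each clique by the letter that produced it. Position 0
  gets \<open>Sig\<close> because there are at least two cliques.\<close>

lemma graph_word_E: "graph_word {..<N} E [0..<N] (inv_into L A) = v"
proof (rule nth_equalityI)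
  fix p assume "p < length (graph_word {..<N} E [0..<N] (inv_into L A))"
  then have p: "p < N" by (simp add: graph_word_def)
  let ?Ks = "{K \<in> A ` L. p \<in> K}"
  have "vlabel {..<N} E (inv_into L A) p = v ! p"
  proof (cases "v ! p")
    case Eps
    then have "?Ks = {}" using A_D by blast
    then show ?thesis using Eps by (simp only: vlabel_def inscribed_eq Let_def card.empty) simp
  next
    case Sig
    then have "p = 0" using v_neq_Sig p by blast
    then have "?Ks = A ` L" using zero_in_A by blast
    then have "card ?Ks \<ge> 2" using two_letters by (simp add: card_image inj_A)
    then show ?thesis using Sig by (simp add: vlabel_def inscribed_eq Let_def)
  next
    case (Prop x)
    have x: "x \<in> L" using Prop_in_L p Prop by blast
    have "?Ks = {A x}"
      using x p Prop pos_of_Prop[OF p Prop] A_disjoint[of x _ p] by (auto simp: A_def)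
    then show ?thesis using Prop x inj_A by (simp add: vlabel_def inscribed_eq Let_def)
  qed
  then show "graph_word {..<N} E [0..<N] (inv_into L A) ! p = v ! p"
    using p by (simp add: graph_word_def)
qed (simp add: graph_word_def N_def)

lemma sunword_v: "word_approx v w \<Longrightarrow> sunword w"
  unfolding sunword_def
  using sunoid_E graph_word_E inj_on_inv_into[of "inscribed {..<N} E" A L] inscribed_eq
  by (metis order_refl)

end

section \<open>Counting letters block by block\<close>

definition pre :: "(nat \<times> nat) list \<Rightarrow> nat \<Rightarrow> nat \<Rightarrow> nat" where
  "pre bs j x = sum_list (map snd (filter (\<lambda>b. fst b = x) (take j bs)))"

lemma pre_0 [simp]: "pre bs 0 x = 0"
  by (simp add: pre_def)

lemma pre_Suc:
  "j < length bs \<Longrightarrow> pre bs (Suc j) x = pre bs j x + (if fst (bs ! j) = x then snd (bs ! j) else 0)"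
  by (simp add: pre_def take_Suc_conv_app_nth)

text \<open>The order half of the \<open>scan\<close> condition, asked once per block: inside a
  block no count of another letter changes.\<close>

definition block_ok :: "(nat \<Rightarrow> nat) \<Rightarrow> (nat \<times> nat) list \<Rightarrow> nat \<Rightarrow> bool" where
  "block_ok h bs j \<longleftrightarrow>
     (\<forall>y\<in>letters bs - {fst (bs ! j)}. odd (pre bs j y) \<longleftrightarrow> h y < h (fst (bs ! j)))"

text \<open>Along a run of \<open>x\<close> the position and the count of \<open>x\<close> advance
  together, so the condition at the first letter carries over to the whole run.\<close>

lemma scan_replicate:
  assumes "l > 0"
  shows "scan L h n c (replicate l (Prop x) @ t) \<longleftrightarrow>
     (even n \<longleftrightarrow> even (c x)) \<and> (\<forall>y\<in>L - {x}. odd (c y) \<longleftrightarrow> h y < h x) \<and>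
     scan L h (n + l) (c(x := c x + l)) t"
  using assms
proof (induction l arbitrary: n c rule: nat_induct_non_zero)
  case (Suc l)
  show ?case
    by (simp add: Suc.IH del: fun_upd_apply) auto
qed simp

lemma scan_blocks_word:
  assumes "\<forall>b\<in>set bs. snd b > 0"
  shows "scan L h n c (blocks_word bs) \<longleftrightarrow> (\<forall>j<length bs.
     (even (n + j + sum_list (map snd (take j bs))) \<longleftrightarrow> even (c (fst (bs ! j)) + pre bs j (fst (bs ! j)))) \<and>
     (\<forall>y\<in>L - {fst (bs ! j)}. odd (c y + pre bs j y) \<longleftrightarrow> h y < h (fst (bs ! j))))"
  using assms
proof (induction bs arbitrary: n c)
  case (Cons b bs)
  obtain x l where b: "b = (x, l)" by fastforce
  have l: "l > 0" using Cons.prems b by simp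
  have c: "(c(x := c x + l)) y + pre bs j y = c y + pre (b # bs) (Suc j) y" for y j
    by (simp add: pre_def b)
  have s: "Suc (n + l) + j + sum_list (map snd (take j bs)) =
    n + Suc j + sum_list (map snd (take (Suc j) (b # bs)))" for j by (simp add: b)
  have IH: "scan L h n c (blocks_word bs) \<longleftrightarrow> (\<forall>j<length bs.
     (even (n + j + sum_list (map snd (take j bs))) \<longleftrightarrow> even (c (fst (bs ! j)) + pre bs j (fst (bs ! j)))) \<and>
     (\<forall>y\<in>L - {fst (bs ! j)}. odd (c y + pre bs j y) \<longleftrightarrow> h y < h (fst (bs ! j))))" for n c
    by (rule Cons.IH) (use Cons.prems in auto)
  have "scan L h n c (blocks_word (b # bs)) \<longleftrightarrow>
     (even n \<longleftrightarrow> even (c x)) \<and> (\<forall>y\<in>L - {x}. odd (c y) \<longleftrightarrow> h y < h x) \<and>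
     scan L h (Suc (n + l)) (c(x := c x + l)) (blocks_word bs)"
  proof (cases bs)
    case Nil
    then show ?thesis using scan_replicate[OF l, of L h n c x "[]"] b by simp
  next
    case (Cons b' bs')
    then show ?thesis using scan_replicate[OF l, of L h n c x "Eps # blocks_word bs"] b
      by (simp del: fun_upd_apply)
  qed
  also have "\<dots> \<longleftrightarrow> (even n \<longleftrightarrow> even (c x)) \<and> (\<forall>y\<in>L - {x}. odd (c y) \<longleftrightarrow> h y < h x) \<and>
     (\<forall>j<length bs. (even (n + Suc j + sum_list (map snd (take (Suc j) (b # bs)))) \<longleftrightarrow>
         even (c (fst (bs ! j)) + pre (b # bs) (Suc j) (fst (bs ! j)))) \<and>
     (\<forall>y\<in>L - {fst (bs ! j)}. odd (c y + pre (b # bs) (Suc j) y) \<longleftrightarrow> h y < h (fst (bs ! j))))"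
    unfolding IH c s ..
  finally show ?case
    by (simp only: length_Cons All_less_Suc2 nth_Cons_0 nth_Cons_Suc take_0 list.map sum_list.Nil
        pre_0 add_0_right b fst_conv conj_assoc)
qed simp

lemma sum_list_pre:
  "sum_list (map snd (take j bs)) = (\<Sum>x\<in>letters bs. pre bs j x)"
proof -
  have fin: "finite (letters bs)" by (simp add: letters_def)
  have "sum_list (map snd xs) = (\<Sum>x\<in>L. sum_list (map snd (filter (\<lambda>b. fst b = x) xs)))"
    if "finite L" "fst ` set xs \<subseteq> L" for xs :: "(nat \<times> nat) list" and L
    using that
  proof (induction xs)
    case (Cons b xs)
    have "(\<Sum>x\<in>L. sum_list (map snd (filter (\<lambda>b. fst b = x) (b # xs)))) =
       (\<Sum>x\<in>L. (if x = fst b then snd b else 0) + sum_list (map snd (filter (\<lambda>b. fst b = x) xs)))"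
      by (intro sum.cong) auto
    also have "\<dots> = snd b + sum_list (map snd xs)"
      unfolding sum.distrib using Cons by simp
    finally show ?case by simp
  qed simp
  from this[OF fin, of "take j bs"] show ?thesis
    unfolding pre_def letters_def by (auto dest: in_set_takeD)
qed

lemma scan_blocks_wordD:
  assumes "sword_blocks bs" "scan (letters bs) h 0 (\<lambda>_. 0) (blocks_word bs)" "j < length bs"
  shows "block_ok h bs j"
proof -
  have pos: "\<forall>b\<in>set bs. snd b > 0" using assms(1) by (simp add: sword_blocks_def)
  show ?thesis
    using assms(2,3) unfolding scan_blocks_word[OF pos] block_ok_def by simp
qed

lemma even_card_rank:
  assumes "finite L" "\<And>y. y \<in> L - {x} \<Longrightarrow> odd (f y) \<longleftrightarrow> h y < h x"
  shows "even (\<Sum>y\<in>L - {x}. f y) \<longleftrightarrow> even (card {y \<in> L. h y < (h x :: nat)})"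
proof -
  have "{y \<in> L - {x}. odd (f y)} = {y \<in> L. h y < h x}" using assms(2) by auto
  then show ?thesis using even_sum_iff[of "L - {x}" f] assms(1) by simp
qed

text \<open>Block \<open>j\<close> starts at position \<open>j\<close>, for the separating blanks,
  plus the counts of all letters. Modulo 2 the count of its own letter cancels and the others
  contribute the number of letters below it, so the position condition of \<open>scan\<close>
  reduces to \<open>par\<close>.\<close>

lemma scan_blocks_wordI:
  assumes "sword_blocks bs" and ok: "\<And>j. j < length bs \<Longrightarrow> block_ok h bs j"
    and par: "\<And>j. j < length bs \<Longrightarrow>
      even j \<longleftrightarrow> even (card {y \<in> letters bs. h y < h (fst (bs ! j))})"
  shows "scan (letters bs) h 0 (\<lambda>_. 0) (blocks_word bs)"
proof -
  have pos: "\<forall>b\<in>set bs. snd b > 0" using assms(1) by (simp add: sword_blocks_def)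
  have fin: "finite (letters bs)" by (simp add: letters_def)
  show ?thesis unfolding scan_blocks_word[OF pos]
  proof (intro allI impI conjI)
    fix j assume j: "j < length bs"
    let ?x = "fst (bs ! j)"
    have x: "?x \<in> letters bs" using j by (simp add: letters_def)
    have s: "sum_list (map snd (take j bs)) = pre bs j ?x + (\<Sum>y\<in>letters bs - {?x}. pre bs j y)"
      unfolding sum_list_pre by (rule sum.remove[OF fin x])
    have "even (\<Sum>y\<in>letters bs - {?x}. pre bs j y) \<longleftrightarrow> even j"
      unfolding par[OF j]
      by (rule even_card_rank[OF fin]) (use ok[OF j] in \<open>simp add: block_ok_def\<close>)
    then show "even (0 + j + sum_list (map snd (take j bs))) \<longleftrightarrow> even (0 + pre bs j ?x)"
      unfolding s by auto
  next
    fix j assume j: "j < length bs"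
    show "\<forall>y\<in>letters bs - {fst (bs ! j)}. odd (0 + pre bs j y) \<longleftrightarrow> h y < h (fst (bs ! j))"
      using ok[OF j] by (simp add: block_ok_def)
  qed
qed

section \<open>Expanding a word to a rim\<close>

lemma red_Eps_Eps_end [simp]: "red (u @ [Eps, Eps]) = red u"
  using red_append_cong[of "[Eps, Eps]" "[]" u] by simp

lemma red_expand: "red (expand u) = red u"
proof (induction u rule: expand.induct)
  case (1 x y r)
  show ?case
  proof (cases "x = y \<and> x \<noteq> Eps \<and> x \<noteq> Sig")
    case True
    then obtain a where a: "x = Prop a" "y = Prop a" by (cases x) auto
    show ?thesis using 1(1)[OF True] unfolding a by simp
  next
    case False
    show ?thesis using red_append_cong[OF 1(2)[OF False], of "[x]"]
      by (simp only: expand.simps(1) if_not_P[OF False] append_Cons append_Nil)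
  qed
qed simp_all

lemma hd_expand: "hd (expand u) = hd u"
  by (induction u rule: expand.induct) auto

lemma expand_eq_Nil_iff [simp]: "expand u = [] \<longleftrightarrow> u = []"
  by (induction u rule: expand.induct) auto

lemma count_list_expand: "count_list (expand u) (Prop x) = count_list u (Prop x)"
  by (induction u rule: expand.induct) auto

lemma even_length_expand: "even (length (expand u)) \<longleftrightarrow> even (length u)"
  by (induction u rule: expand.induct) auto

lemma expand_spaced:
  assumes "successively (\<lambda>a b. a = Eps \<or> b = Eps \<or> a = b) u" "Sig \<notin> set u"
  shows "successively (\<lambda>a b. a = Eps \<or> b = Eps) (expand u)"
  using assms
proof (induction u rule: expand.induct)
  case (1 x y r)
  then show ?case by (auto simp: successively_Cons hd_expand)
qed auto

lemma blocks_word_successively: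
  assumes "\<forall>b\<in>set bs. snd b > 0"
  shows "successively (\<lambda>a b. a = Eps \<or> b = Eps \<or> a = b) (blocks_word bs)"
  using assms
proof (induction bs rule: blocks_word.induct)
  have rep: "successively (\<lambda>a b. a = Eps \<or> b = Eps \<or> a = b) (replicate l (Prop x))" for l x
    by (simp add: successively_conv_nth)
  case (2 x l)
  show ?case using rep by simp
next
  have rep: "successively (\<lambda>a b. a = Eps \<or> b = Eps \<or> a = b) (replicate l (Prop x))" for l x
    by (simp add: successively_conv_nth)
  case (3 x l b r)
  then show ?case by (auto simp: successively_append_iff successively_Cons rep)
qed simp

lemma count_blocks_word: "count_list (blocks_word bs) (Prop x) = pre bs (length bs) x"
proof -
  have "count_list (replicate l a) a' = (if a = a' then l else 0)" for l and a a' :: letter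
    by (induction l) auto
  then show ?thesis
    unfolding pre_def by (induction bs rule: blocks_word.induct) auto
qed

lemma length_blocks_word:
  "bs \<noteq> [] \<Longrightarrow> Suc (length (blocks_word bs)) = sum_list (map snd bs) + length bs"
  by (induction bs rule: blocks_word.induct) auto

lemma pre_length_even: "sword_blocks bs \<Longrightarrow> even (pre bs (length bs) x)"
  by (simp add: sword_blocks_def pre_def)

lemma red_vword: "red (vword bs) = Sig # red (blocks_word bs)"
  using red_append_Sig[of "[]" "Eps # Eps # expand (blocks_word bs) @ [Eps, Eps]"]
    red_Eps_Eps_end[of "expand (blocks_word bs)"]
  by (simp add: vword_def sword_of_def red_expand del: red.simps(2))

lemma vword_balanced:
  assumes sb: "sword_blocks bs" and "card (letters bs) \<ge> 2" "odd (length bs)"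
    and h: "inj_on h (letters bs)" "scan (letters bs) h 0 (\<lambda>_. 0) (blocks_word bs)"
  shows "balanced_word (vword bs) h" "{x. Prop x \<in> set (vword bs)} = letters bs"
proof -
  have pos: "\<forall>b\<in>set bs. snd b > 0" and ne: "bs \<noteq> []" using sb by (auto simp: sword_blocks_def)
  note bw = blocks_word_props[OF pos]
  define e where "e = expand (blocks_word bs)"
  have v: "vword bs = Sig # Eps # Eps # e @ [Eps, Eps]"
    by (simp add: vword_def sword_of_def e_def)
  have in_e: "a \<in> set e \<longleftrightarrow> a \<in> set (blocks_word bs)" if "a \<noteq> Eps" for a
    using in_set_red[OF that, of e] in_set_red[OF that, of "blocks_word bs"]
    by (simp add: e_def red_expand)
  show L: "{x. Prop x \<in> set (vword bs)} = letters bs"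
    using in_e bw(3) by (auto simp: v)
  have "successively (\<lambda>a b. a = Eps \<or> b = Eps) e"
    unfolding e_def by (rule expand_spaced[OF blocks_word_successively[OF pos] bw(2)])
  then have succ: "successively (\<lambda>a b. a = Eps \<or> b = Eps) (vword bs)"
    by (auto simp: v successively_Cons successively_append_iff)
  \<comment> \<open>Towards an odd rim length: the weights have even sum, an odd number of blocks
    has an even number of separators, \<open>expand\<close> adds pairs, and \<open>Sig\<close> with
    four more blanks makes the total odd.\<close>
  have "even (sum_list (map snd bs))"
  proof -
    have "sum_list (map snd bs) = (\<Sum>x\<in>letters bs. pre bs (length bs) x)"
      using sum_list_pre[of "length bs" bs] by simp
    then show ?thesis using pre_length_even[OF sb] by (simp add: dvd_sum)
  qed
  then have "even (length (blocks_word bs))"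
    using arg_cong[OF length_blocks_word[OF ne], of even] \<open>odd (length bs)\<close> by simp
  then have odd: "odd (length (vword bs))" by (simp add: v e_def even_length_expand)
  show "balanced_word (vword bs) h"
  proof (unfold_locales, unfold L)
    fix i assume i: "i < length (vword bs)" "vword bs ! i \<noteq> Eps"
    show "vword bs ! ((i + 1) mod length (vword bs)) = Eps"
    proof (cases "Suc i = length (vword bs)")
      case True
      have "vword bs ! i = last (vword bs)" using True by (simp add: last_conv_nth v)
      also have "\<dots> = Eps" by (simp add: v)
      finally show ?thesis using i(2) by simp
    next
      case False
      then have "Suc i < length (vword bs)" using i(1) by simp
      then show ?thesis using succ i(2) by (auto simp: successively_conv_nth)
    qed
  next
    show "even (count_list (vword bs) (Prop x))" for x
      using pre_length_even[OF sb] by (simp add: v e_def count_list_expand count_blocks_word)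
  next
    have "red (tl (vword bs)) = red (blocks_word bs)"
      by (simp add: v e_def red_expand del: red.simps(2))
    then show "scan (letters bs) h 0 (\<lambda>_. 0) (tl (vword bs))"
      using h(2) scan_red[of "letters bs" h 0 "\<lambda>_. 0"] by metis
  next
    show "Sig \<notin> set (tl (vword bs))" using in_e[of Sig] bw(2) by (simp add: v)
  qed (use odd assms in \<open>simp_all add: v\<close>)
qed

theorem scan_sunword:
  assumes "sword_blocks bs" "card (letters bs) \<ge> 2" "odd (length bs)"
    and "inj_on h (letters bs)" "scan (letters bs) h 0 (\<lambda>_. 0) (blocks_word bs)"
  shows "sunword (sword_of bs)"
proof -
  interpret balanced_word "vword bs" h "length (vword bs)" "{x. Prop x \<in> set (vword bs)}"
    by (rule vword_balanced(1)[OF assms])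
  have "word_sim u u" for u unfolding word_sim_def by (rule exI[of _ 0]) simp
  then have "word_approx (vword bs) (sword_of bs)"
    using red_vword[of bs] by (simp add: word_approx_def pattern_eq_red sword_of_def)
  then show ?thesis by (rule sunword_v)
qed

section \<open>Comparison with the induced order\<close>

lemma (in balanced_word) occurs_around:
  assumes "x \<in> L" "i < N" "v ! i = Prop y" "h x < h y"
  shows "\<exists>j<i. v ! j = Prop x" "\<exists>j>i. j < N \<and> v ! j = Prop x"
proof -
  have "x \<noteq> y" using assms(4) by auto
  \<comment> \<open>An odd count is positive; as the total is even and position \<open>i\<close>
    itself carries \<open>y\<close>, the count after \<open>i\<close> is odd too, so
    \<open>x\<close> occurs on both sides.\<close>
  then have odd: "odd (cnt x i)" using cnt_parity(2)[of i y x] assms by simp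
  then have "Prop x \<in> set (take i v)"
    unfolding cnt_def by (metis count_notin even_zero)
  then show "\<exists>j<i. v ! j = Prop x"
    using assms(2) by (auto simp: in_set_conv_nth N_def)
  show "\<exists>j>i. j < N \<and> v ! j = Prop x"
  proof (rule ccontr)
    assume "\<not> ?thesis"
    then have "cnt x N = cnt x i"
      using cnt_step[of i N x] assms(2,3) \<open>x \<noteq> y\<close> by auto
    then show False using odd cnt_N[of x] by simp
  qed
qed

text \<open>Take the occurrence of \<open>y\<close> closest to position 0. Some \<open>x\<close>
  comes earlier and some \<open>x\<close> later in the word, so on whichever side the distance is
  attained an \<open>x\<close> is strictly closer.\<close>

lemma ldist_less:
  assumes "balanced_word (vword bs) h" "Prop x \<in> set (vword bs)" "Prop y \<in> set (vword bs)" "h x < h y"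
  shows "ldist bs x < ldist bs y"
proof -
  interpret balanced_word "vword bs" h "length (vword bs)" "{x. Prop x \<in> set (vword bs)}"
    by fact
  let ?N = "length (vword bs)"
  let ?D = "\<lambda>x. {min i (?N - i) | i. i < ?N \<and> vword bs ! i = Prop x}"
  have ld: "ldist bs z = Min (?D z)" for z by (simp add: ldist_def Let_def)
  have fin: "finite (?D z)" for z by simp
  have "?D y \<noteq> {}" using assms(3) by (auto simp: in_set_conv_nth)
  then have "Min (?D y) \<in> ?D y" by (rule Min_in[OF fin])
  then obtain i where i: "i < ?N" "vword bs ! i = Prop y" "Min (?D y) = min i (?N - i)" by auto
  obtain j where j: "j < i" "vword bs ! j = Prop x" using occurs_around(1)[of x i y] i assms by auto
  obtain k where k: "i < k" "k < ?N" "vword bs ! k = Prop x"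
    using occurs_around(2)[of x i y] i assms by auto
  have "Min (?D x) \<le> min j (?N - j)" by (rule Min_le[OF fin]) (use j i in auto)
  moreover have "Min (?D x) \<le> min k (?N - k)" by (rule Min_le[OF fin]) (use k in auto)
  ultimately show ?thesis unfolding ld i(3) using j k i(1) by linarith
qed

section \<open>Dyck paths\<close>

text \<open>The rank with respect to \<open>h\<close>; it coincides with \<open>rank\<close> once
  \<open>h\<close> and \<open>prec\<close> are known to agree.\<close>

definition height :: "(nat \<Rightarrow> nat) \<Rightarrow> (nat \<times> nat) list \<Rightarrow> nat \<Rightarrow> nat" where
  "height h bs x = card {y \<in> letters bs. h y < h x}"

lemma block_letter: "j < length bs \<Longrightarrow> fst (bs ! j) \<in> letters bs"
  by (simp add: letters_def)

lemma finite_letters: "finite (letters bs)"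
  by (simp add: letters_def)

lemma D_W_nth:
  "j < length bs \<Longrightarrow> D_W bs ! j = (int j, int (rank bs (fst (repr bs ! j))))"
  by (simp add: D_W_def)

text \<open>Abscissas are right by construction, so only the ranks remain; a descent is written with
  \<open>Suc\<close> to avoid subtraction of natural numbers. \<open>is_peak\<close> only compares
  the two neighbours, so it covers valleys as well.\<close>

lemma dyck_path_is_peak_iff:
  assumes "repr bs = bs" "length bs = Suc (2 * n)"
  defines "r \<equiv> \<lambda>i. rank bs (fst (bs ! i))"
  shows "dyck_path (D_W bs) n \<longleftrightarrow> r 0 = 0 \<and> r (2 * n) = 0 \<and>
      (\<forall>i<2 * n. r (Suc i) = Suc (r i) \<or> r i = Suc (r (Suc i)))"
    and "i \<le> 2 * n \<Longrightarrow> is_peak (D_W bs) n i \<longleftrightarrow> 0 < i \<and> i < 2 * n \<and> r (i - 1) = r (Suc i)"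
proof -
  have D: "D_W bs ! i = (int i, int (r i))" if "i \<le> 2 * n" for i
    using that assms(2) D_W_nth[of i bs] by (simp add: assms(1) r_def)
  have "length (D_W bs) = 2 * n + 1" using assms(2) by (simp add: D_W_def)
  then show "dyck_path (D_W bs) n \<longleftrightarrow> r 0 = 0 \<and> r (2 * n) = 0 \<and>
      (\<forall>i<2 * n. r (Suc i) = Suc (r i) \<or> r i = Suc (r (Suc i)))"
    unfolding dyck_path_def using D by fastforce
  show "is_peak (D_W bs) n i \<longleftrightarrow> 0 < i \<and> i < 2 * n \<and> r (i - 1) = r (Suc i)" if "i \<le> 2 * n"
    using that D[of "i - 1"] D[of "Suc i"] unfolding is_peak_def by auto
qed

context
  fixes bs :: "(nat \<times> nat) list" and h :: "nat \<Rightarrow> nat"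
  assumes sb: "sword_blocks bs" and two: "card (letters bs) \<ge> 2"
    and inj: "inj_on h (letters bs)" and ok: "\<And>j. j < length bs \<Longrightarrow> block_ok h bs j"
begin

abbreviation letter_at :: "nat \<Rightarrow> nat" where "letter_at j \<equiv> fst (bs ! j)"
abbreviation height_at :: "nat \<Rightarrow> nat" where "height_at j \<equiv> height h bs (letter_at j)"

lemma X_neq: "Suc j < length bs \<Longrightarrow> letter_at j \<noteq> letter_at (Suc j)"
  using sb by (simp add: sword_blocks_def)

lemma bs_ne: "0 < length bs"
  using sb by (simp add: sword_blocks_def)

lemma pre_odd:
  "j < length bs \<Longrightarrow> y \<in> letters bs \<Longrightarrow> y \<noteq> letter_at j \<Longrightarrow> odd (pre bs j y) \<longleftrightarrow> h y < h (letter_at j)"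
  using ok[of j] by (simp add: block_ok_def)

lemma length_gt_1: "1 < length bs"
proof (rule ccontr)
  assume "\<not> ?thesis"
  then obtain b where "bs = [b]" using bs_ne by (cases bs) auto
  then show False using two by (simp add: letters_def)
qed

lemma height_first: "height_at 0 = 0"
proof -
  have "{y \<in> letters bs. h y < h (letter_at 0)} = {}"
    using pre_odd[OF bs_ne] by force
  then show ?thesis by (simp only: height_def card.empty)
qed

text \<open>Before the last block every letter other than its own has reached its total count, which
  is even, so none is lower.\<close>

lemma height_last: "height_at (length bs - 1) = 0"
proof -
  let ?j = "length bs - 1"
  have j: "?j < length bs" "Suc ?j = length bs" using bs_ne by simp_all
  have "\<not> h y < h (letter_at ?j)" if y: "y \<in> letters bs" for y
  proof (cases "y = letter_at ?j")
    case False
    then have "pre bs (length bs) y = pre bs ?j y"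
      using pre_Suc[OF j(1), of y] j(2) by simp
    then show ?thesis using pre_odd[OF j(1) y False] pre_length_even[OF sb, of y] by simp
  qed simp
  then have "{y \<in> letters bs. h y < h (letter_at ?j)} = {}" by blast
  then show ?thesis by (simp only: height_def card.empty)
qed

text \<open>Block \<open>j\<close> changes only the count of its own letter. Every third letter is
  therefore below both letters or below neither, and nothing lies between them in the order.\<close>

lemma height_step:
  assumes j: "Suc j < length bs"
  shows "height_at (Suc j) = Suc (height_at j) \<and> h (letter_at j) < h (letter_at (Suc j)) \<or>
    height_at j = Suc (height_at (Suc j)) \<and> h (letter_at (Suc j)) < h (letter_at j)"
proof -
  have L: "letter_at j \<in> letters bs" "letter_at (Suc j) \<in> letters bs" using block_letter j by simp_all
  have same: "h y < h (letter_at j) \<longleftrightarrow> h y < h (letter_at (Suc j))"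
    if "y \<in> letters bs" "y \<noteq> letter_at j" "y \<noteq> letter_at (Suc j)" for y
    using pre_odd[of j y] pre_odd[OF j, of y] pre_Suc[of j bs y] that j by simp
  have ins: "card (insert a {y \<in> letters bs. h y < h a}) = Suc (card {y \<in> letters bs. h y < h a})" for a
    by (rule card_insert_disjoint) (use finite_letters in auto)
  consider "h (letter_at j) < h (letter_at (Suc j))" | "h (letter_at (Suc j)) < h (letter_at j)"
    using inj_onD[OF inj _ L] X_neq[OF j] by fastforce
  then show ?thesis
  proof cases
    case 1
    then have "{y \<in> letters bs. h y < h (letter_at (Suc j))} = insert (letter_at j) {y \<in> letters bs. h y < h (letter_at j)}"
      using same L by (auto dest: less_trans)
    then show ?thesis using 1 ins[of "letter_at j"] by (simp add: height_def)
  next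
    case 2
    then have "{y \<in> letters bs. h y < h (letter_at j)} = insert (letter_at (Suc j)) {y \<in> letters bs. h y < h (letter_at (Suc j))}"
      using same L by (auto dest: less_trans)
    then show ?thesis using 2 ins[of "letter_at (Suc j)"] by (simp add: height_def)
  qed
qed

lemma height_parity: "j < length bs \<Longrightarrow> even (height_at j) \<longleftrightarrow> even j"
proof (induction j)
  case (Suc j)
  then show ?case using height_step[of j] by auto
qed (simp add: height_first)

text \<open>Steps of size one from height 0 back to height 0 are even in number.\<close>

lemma odd_length: "odd (length bs)"
  using height_parity[of "length bs - 1"] height_last bs_ne by auto

text \<open>The prefix count of the letter of block \<open>j\<close> has its parity fixed by the left neighbour before the
  block and by the right neighbour after it; the weight is the difference.\<close>
lemma weight_parity:
  assumes j: "j < length bs"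
  shows "odd (snd (bs ! j)) \<longleftrightarrow> \<not> (0 < j \<and> Suc j < length bs \<and> height_at (j - 1) = height_at (Suc j))"
proof -
  have before: "odd (pre bs j (letter_at j)) \<longleftrightarrow> 0 < j \<and> h (letter_at j) < h (letter_at (j - 1))"
  proof (cases j)
    case (Suc i)
    then have "pre bs j (letter_at j) = pre bs i (letter_at j)" using pre_Suc[of i bs "letter_at j"] X_neq[of i] j by simp
    then show ?thesis using pre_odd[of i "letter_at j"] X_neq[of i] block_letter[OF j] j Suc by simp
  qed simp
  have after: "odd (pre bs (Suc j) (letter_at j)) \<longleftrightarrow> Suc j < length bs \<and> h (letter_at j) < h (letter_at (Suc j))"
  proof (cases "Suc j < length bs")
    case True
    then show ?thesis using pre_odd[OF True block_letter[OF j] X_neq] by simp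
  next
    case False
    then have "Suc j = length bs" using j by simp
    then show ?thesis using pre_length_even[OF sb, of "letter_at j"] by simp
  qed
  have left: "height_at j = Suc (height_at (j - 1)) \<and> \<not> h (letter_at j) < h (letter_at (j - 1)) \<or>
      height_at (j - 1) = Suc (height_at j) \<and> h (letter_at j) < h (letter_at (j - 1))" if "0 < j"
    using height_step[of "j - 1"] that j by auto
  have right: "height_at (Suc j) = Suc (height_at j) \<and> h (letter_at j) < h (letter_at (Suc j)) \<or>
      height_at j = Suc (height_at (Suc j)) \<and> \<not> h (letter_at j) < h (letter_at (Suc j))" if "Suc j < length bs"
    using height_step[OF that] by auto
  have w: "odd (snd (bs ! j)) \<longleftrightarrow> (odd (pre bs j (letter_at j)) \<longleftrightarrow> even (pre bs (Suc j) (letter_at j)))"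
    using pre_Suc[OF j, of "letter_at j"] by auto
  show ?thesis
  proof (cases "0 < j"; cases "Suc j < length bs")
    assume "0 < j" "Suc j < length bs"
    then show ?thesis using w before after left right by auto
  next
    assume "0 < j" "\<not> Suc j < length bs"
    then have "height_at j = 0" using height_last j by (metis Suc_lessI diff_Suc_1)
    then show ?thesis using w before after left \<open>0 < j\<close> \<open>\<not> Suc j < length bs\<close> by auto
  next
    assume "\<not> 0 < j" "Suc j < length bs"
    then show ?thesis using w before after right height_first by auto
  qed (use length_gt_1 in simp)
qed

lemma dyck_of_scan:
  assumes scan: "scan (letters bs) h 0 (\<lambda>_. 0) (blocks_word bs)"
  shows "DW_defined bs \<and> evenly_weighted_dyck (D_W bs) (Lambda_W bs)"
proof -
  note bal = vword_balanced[OF sb two odd_length inj scan]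
  have "prec bs x y" if "x \<in> letters bs" "y \<in> letters bs" "h x < h y" for x y
    unfolding prec_def using ldist_less[OF bal(1), of x y] bal(2) that by blast
  then have prec: "prec bs x y \<longleftrightarrow> h x < h y" if "x \<in> letters bs" "y \<in> letters bs" for x y
    using that inj by (metis inj_onD linorder_neqE_nat not_less_iff_gr_or_eq prec_def)
  have tot: "prec_total bs"
    unfolding prec_total_def using prec inj by (metis inj_onD linorder_neqE_nat)
  have rank: "rank bs x = height h bs x" if "x \<in> letters bs" for x
  proof -
    have "{y \<in> letters bs. prec bs y x} = {y \<in> letters bs. h y < h x}" using prec that by blast
    then show ?thesis by (simp only: rank_def height_def)
  qed
  have X0: "letter_at 0 \<in> letters bs" using block_letter[OF bs_ne] .
  \<comment> \<open>The path starts at height 0, so the letter of the first block is the least one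
    and \<open>repr\<close> does not reverse.\<close>
  have "{y \<in> letters bs. h y < h (letter_at 0)} = {}"
    using height_first finite_letters[of bs] by (simp add: height_def)
  then have least: "h (letter_at 0) < h y" if "y \<in> letters bs" "y \<noteq> letter_at 0" for y
    using that X0 inj_onD[OF inj] by (metis (mono_tags, lifting) empty_iff linorder_neqE_nat mem_Collect_eq)
  have "least_letter bs = letter_at 0"
    unfolding least_letter_def
  proof (rule the_equality)
    show "letter_at 0 \<in> letters bs \<and> (\<forall>y\<in>letters bs. y \<noteq> letter_at 0 \<longrightarrow> prec bs (letter_at 0) y)"
      using least prec X0 by blast
    show "a = letter_at 0" if "a \<in> letters bs \<and> (\<forall>y\<in>letters bs. y \<noteq> a \<longrightarrow> prec bs a y)" for a
      using that least[of a] prec[of a "letter_at 0"] X0 by (metis less_asym)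
  qed
  moreover have hd: "fst (hd bs) = letter_at 0" using bs_ne by (simp add: hd_conv_nth)
  ultimately have repr: "repr bs = bs" by (simp add: repr_def)
  then have "DW_defined bs" using tot hd \<open>least_letter bs = letter_at 0\<close> by (simp add: DW_defined_def)
  moreover obtain n where n: "length bs = Suc (2 * n)" using odd_length by (metis oddE Suc_eq_plus1)
  note dyck = dyck_path_is_peak_iff[OF repr n]
  have rX: "rank bs (letter_at i) = height_at i" if "i \<le> 2 * n" for i using rank block_letter n that by simp
  have "dyck_path (D_W bs) n"
    unfolding dyck(1) using height_first height_last height_step rX n by auto
  moreover have "snd (bs ! i) > 0" if "i \<le> 2 * n" for i
    using sb nth_mem[of i bs] that n by (simp add: sword_blocks_def)
  moreover have "odd (snd (bs ! i)) \<longleftrightarrow> \<not> is_peak (D_W bs) n i" if "i \<le> 2 * n" for i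
    unfolding dyck(2)[OF that] using weight_parity[of i] that n rX[of "i - 1"] rX[of "Suc i"] by auto
  ultimately show ?thesis
    unfolding evenly_weighted_dyck_def Lambda_W_def repr by blast
qed

end

section \<open>From a weighted Dyck path back to prefix counts\<close>

lemma rank_less_iff:
  assumes "prec_total bs" "x \<in> letters bs" "y \<in> letters bs"
  shows "rank bs x < rank bs y \<longleftrightarrow> prec bs x y"
proof -
  have "rank bs x < rank bs y" if "prec bs x y" "x \<in> letters bs" for x y
    unfolding rank_def
    by (rule psubset_card_mono) (use that finite_letters in \<open>auto simp: prec_def\<close>)
  then show ?thesis using assms unfolding prec_total_def by (metis less_asym less_irrefl)
qed

lemma scan_of_dyck:
  assumes sb: "sword_blocks bs" and two: "card (letters bs) \<ge> 2"
    and def: "DW_defined bs" and dyck: "evenly_weighted_dyck (D_W bs) (Lambda_W bs)"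
  shows "odd (length bs)" "inj_on (rank bs) (letters bs)"
    "scan (letters bs) (rank bs) 0 (\<lambda>_. 0) (blocks_word bs)"
proof -
  have tot: "prec_total bs" using def by (simp add: DW_defined_def)
  note less = rank_less_iff[OF tot]
  show inj: "inj_on (rank bs) (letters bs)"
    using tot less unfolding inj_on_def prec_total_def by (metis less_irrefl)
  from dyck obtain n where n: "dyck_path (D_W bs) n"
    and wt: "\<And>i. i \<le> 2 * n \<Longrightarrow> odd (Lambda_W bs i) \<longleftrightarrow> \<not> is_peak (D_W bs) n i"
    unfolding evenly_weighted_dyck_def by blast
  have len: "length bs = Suc (2 * n)" using n by (simp add: dyck_path_def D_W_def)
  then show "odd (length bs)" by simp
  have ne: "bs \<noteq> []" using sb by (simp add: sword_blocks_def)
  \<comment> \<open>A Dyck path has ordinate 0 at both ends and ranks are injective, so the first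
    and the last block carry the same letter; a reversal would then contradict
    \<open>DW_defined\<close>.\<close>
  have repr: "repr bs = bs"
  proof (rule ccontr)
    assume "repr bs \<noteq> bs"
    then have rv: "repr bs = rev bs" "fst (hd bs) \<noteq> least_letter bs"
      by (auto simp: repr_def split: if_splits)
    have "D_W bs ! 0 = (0, 0)" "D_W bs ! (2 * n) = (int (2 * n), 0)"
      using n by (auto simp: dyck_path_def)
    then have "rank bs (fst (rev bs ! 0)) = 0" "rank bs (fst (rev bs ! (2 * n))) = 0"
      using len D_W_nth[of 0 bs] D_W_nth[of "2 * n" bs] by (simp_all add: rv)
    moreover have "rev bs ! (2 * n) = bs ! 0" using len by (simp add: rev_nth)
    moreover have "fst (rev bs ! 0) \<in> letters bs" "fst (bs ! 0) \<in> letters bs"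
      using len block_letter[of 0 "rev bs"] block_letter[of 0 bs] by (simp_all add: letters_def)
    ultimately have "fst (rev bs ! 0) = fst (bs ! 0)"
      using inj_onD[OF inj, of "fst (rev bs ! 0)" "fst (bs ! 0)"] by simp
    then show False using rv def ne by (simp add: DW_defined_def hd_conv_nth)
  qed
  define r where "r i = rank bs (fst (bs ! i))" for i
  note dyck_iff = dyck_path_is_peak_iff[OF repr len, folded r_def]
  have r0: "r 0 = 0" and step: "\<And>i. i < 2 * n \<Longrightarrow> r (Suc i) = Suc (r i) \<or> r i = Suc (r (Suc i))"
    using n dyck_iff(1) by blast+
  have wt': "odd (snd (bs ! i)) \<longleftrightarrow> \<not> (0 < i \<and> i < 2 * n \<and> r (i - 1) = r (Suc i))" if "i \<le> 2 * n" for i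
    using wt[OF that] dyck_iff(2)[OF that] by (simp add: Lambda_W_def repr)
  \<comment> \<open>The block condition is silent about the block's own letter; for the induction to
    run, the parity there is recorded too: odd exactly if the path has just descended to this
    block.\<close>
  have inv: "\<forall>y\<in>letters bs. odd (pre bs j y) \<longleftrightarrow>
      (if y = fst (bs ! j) then 0 < j \<and> r j < r (j - 1) else rank bs y < r j)" if "j \<le> 2 * n" for j
    using that
  proof (induction j)
    case 0
    then show ?case using r0 by simp
  next
    case (Suc j)
    let ?x = "fst (bs ! j)" and ?x' = "fst (bs ! Suc j)"
    have j: "j < length bs" "Suc j < length bs" using Suc.prems len by simp_all
    note L = j[THEN block_letter]
    have st: "r (Suc j) = Suc (r j) \<or> r j = Suc (r (Suc j))" using step Suc.prems by simp
    then have ne: "?x \<noteq> ?x'" unfolding r_def by auto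
    have rx: "r j = rank bs ?x" "r (Suc j) = rank bs ?x'" by (simp_all add: r_def)
    note IH = Suc.IH[THEN bspec]
    show ?case
    proof (intro ballI)
      fix y assume y: "y \<in> letters bs"
      show "odd (pre bs (Suc j) y) \<longleftrightarrow>
        (if y = ?x' then 0 < Suc j \<and> r (Suc j) < r (Suc j - 1) else rank bs y < r (Suc j))"
      proof (cases "y = ?x")
        case True
        have "odd (pre bs (Suc j) y) \<longleftrightarrow> (odd (snd (bs ! j)) \<longleftrightarrow> \<not> (0 < j \<and> r j < r (j - 1)))"
          using pre_Suc[OF j(1), of y] IH[OF _ y] Suc.prems True by auto
        \<comment> \<open>An even weight, at a turn of the path, keeps the parity; an odd weight,
          where the path starts or continues, flips it. Either way the count is odd on leaving the
          block exactly if the path goes up.\<close>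
        also have "\<dots> \<longleftrightarrow> r j < r (Suc j)"
        proof (cases "j = 0")
          case True
          then show ?thesis using wt'[of j] r0 st by simp
        next
          case False
          then have "r j = Suc (r (j - 1)) \<or> r (j - 1) = Suc (r j)"
            using step[of "j - 1"] Suc.prems by simp
          then show ?thesis using wt'[of j] st False Suc.prems by auto
        qed
        finally show ?thesis using True ne rx by simp
      next
        case False
        then have "odd (pre bs (Suc j) y) \<longleftrightarrow> rank bs y < r j"
          using pre_Suc[OF j(1), of y] IH[OF _ y] Suc.prems by simp
        moreover have "rank bs y \<noteq> r j" using inj_onD[OF inj _ y L(1)] False rx by auto
        moreover have "rank bs y = r (Suc j) \<longleftrightarrow> y = ?x'" using inj_onD[OF inj _ y L(2)] rx by auto
        ultimately show ?thesis using st by auto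
      qed
    qed
  qed
  have par: "even j \<longleftrightarrow> even (r j)" if "j \<le> 2 * n" for j
    using that
  proof (induction j)
    case (Suc j)
    then show ?case using step[of j] by auto
  qed (simp add: r0)
  \<comment> \<open>With \<open>rank\<close> itself as the order, the number of lower letters is
    again the rank, that is, the ordinate whose parity \<open>par\<close> controls.\<close>
  have card: "card {y \<in> letters bs. rank bs y < rank bs x} = rank bs x" if "x \<in> letters bs" for x
  proof -
    have "{y \<in> letters bs. rank bs y < rank bs x} = {y \<in> letters bs. prec bs y x}"
      using less that by blast
    then show ?thesis by (simp only: rank_def)
  qed
  show "scan (letters bs) (rank bs) 0 (\<lambda>_. 0) (blocks_word bs)"
  proof (rule scan_blocks_wordI[OF sb])
    fix j assume j: "j < length bs"
    then have j': "j \<le> 2 * n" using len by simp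
    show "block_ok (rank bs) bs j"
      using inv[OF j'] by (auto simp: block_ok_def r_def)
    show "even j \<longleftrightarrow> even (card {y \<in> letters bs. rank bs y < rank bs (fst (bs ! j))})"
      using par[OF j'] card[OF block_letter[OF j]] by (simp add: r_def)
  qed
qed

theorem theorem8:
  fixes bs :: "(nat \<times> nat) list"
  assumes "sword_blocks bs"
    and "card (letters bs) \<ge> 2"
  shows "sunword (sword_of bs) \<longleftrightarrow>
           (DW_defined bs \<and> evenly_weighted_dyck (D_W bs) (Lambda_W bs))"
proof
  assume "sunword (sword_of bs)"
  then obtain h where h: "inj_on h (letters bs)" "scan (letters bs) h 0 (\<lambda>_. 0) (blocks_word bs)"
    using sunword_scan assms(1) by blast
  show "DW_defined bs \<and> evenly_weighted_dyck (D_W bs) (Lambda_W bs)"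
    by (rule dyck_of_scan[OF assms h(1) _ h(2)]) (rule scan_blocks_wordD[OF assms(1) h(2)])
next
  assume "DW_defined bs \<and> evenly_weighted_dyck (D_W bs) (Lambda_W bs)"
  then show "sunword (sword_of bs)"
    using scan_sunword[OF assms] scan_of_dyck[OF assms] by blast
qed

end
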